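(* For every even positive integer $d$ and every positive integer $k$ there exists a positive integer $n(d,k)$ such that for every $n\ge n(d,k)$ and every homogeneous polynomial $f$ of degree $d$ on $\mathbb R^n$ (with real coefficients) there exists a $k$-dimensional linear subspace $V\subseteq\mathbb R^n$ such that the restriction $f|_V$ is proportional to the restriction to $V$ of $Q^{d/2}$, where $Q=x_1^2+x_2^2+\dots+x_n^2$ is the standard quadratic form.
   Context: "$f|_V$ is proportional to $Q^{d/2}|_V$" means that there is a real constant $c$ (possibly zero or negative) with $f(x)=c\,Q(x)^{d/2}$ for all $x\in V$. *)

theory Defs
  imports Complex_Main "HOL-Library.Function_Algebras" "HOL-Library.Poly_Mapping"
begin

text \<open>
  The dimension varies inside the statement, so $\mathbf{R}^n$ is the space of real sequences
  that vanish from index \<open>n\<close> on; the coordinates $x_1, \dots, x_n$ are \<open>x 0, \<dots>, x (n - 1)\<close>.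
  \<open>seq_space.subspace\<close> and \<open>seq_space.dim\<close> are the notions of \<^theory>\<open>HOL.Vector_Spaces\<close>.
\<close>

definition seq_scale :: "real \<Rightarrow> (nat \<Rightarrow> real) \<Rightarrow> nat \<Rightarrow> real" where
  "seq_scale c x = (\<lambda>i. c * x i)"

global_interpretation seq_space: vector_space seq_scale
  by unfold_locales (simp_all add: seq_scale_def fun_eq_iff algebra_simps)

definition Rn :: "nat \<Rightarrow> (nat \<Rightarrow> real) set" where
  "Rn n = {x. \<forall>i\<ge>n. x i = 0}"

text \<open>
  A polynomial is a finitely supported map from exponent vectors to coefficients. The zero
  polynomial counts as homogeneous of every degree.
\<close>

type_synonym rpoly = "(nat \<Rightarrow>\<^sub>0 nat) \<Rightarrow>\<^sub>0 real"

definition homogeneous_poly :: "nat \<Rightarrow> nat \<Rightarrow> rpoly \<Rightarrow> bool" where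
  "homogeneous_poly n d p \<longleftrightarrow>
     (\<forall>m \<in> Poly_Mapping.keys p.
        Poly_Mapping.keys m \<subseteq> {..<n} \<and>
        (\<Sum>i\<in>Poly_Mapping.keys m. Poly_Mapping.lookup m i) = d)"

definition poly_fun :: "rpoly \<Rightarrow> (nat \<Rightarrow> real) \<Rightarrow> real" where
  "poly_fun p x =
     (\<Sum>m\<in>Poly_Mapping.keys p. Poly_Mapping.lookup p m *
        (\<Prod>i\<in>Poly_Mapping.keys m. x i ^ Poly_Mapping.lookup m i))"

definition std_quad :: "nat \<Rightarrow> (nat \<Rightarrow> real) \<Rightarrow> real" where
  "std_quad n x = (\<Sum>i<n. (x i)\<^sup>2)"

definition proportional_on ::
    "(nat \<Rightarrow> real) set \<Rightarrow> ((nat \<Rightarrow> real) \<Rightarrow> real) \<Rightarrow> ((nat \<Rightarrow> real) \<Rightarrow> real) \<Rightarrow> bool" where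
  "proportional_on V f g \<longleftrightarrow> (\<exists>c::real. \<forall>x\<in>V. f x = c * g x)"

end

theory Submission
  imports Defs "HOL-Analysis.Function_Topology"
begin

text \<open>
  Induction on \<open>d\<close>, for all degrees and with radial restrictions \<open>c |x|^d\<close> (so \<open>c = 0\<close> is forced
  when \<open>d\<close> is odd). If \<open>x\<close> and \<open>y\<close> range over orthogonal subspaces, every mixed part of
  \<open>f (x + y)\<close> has degree less than \<open>d\<close> in \<open>x\<close> and in \<open>y\<close>, so by induction the subspaces can be
  chosen such that the mixed parts depend on \<open>|x|\<close> and \<open>|y|\<close> only. Iterating gives isometric
  embeddings \<open>A_0, \<dots>, A_m\<close> of $\mathbf{R}^k$ with orthogonal images such that
  \<open>f (\<Sum>j. t_j A_j R_j x) = \<Sum>j. t_j^d g_j (R_j x)\<close> plus a function of the \<open>t_j\<close> and \<open>|x|\<close>, for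
  all orthogonal \<open>R_j\<close>, where \<open>g_j = f \<circ> A_j\<close>. The average of \<open>g_j \<circ> R\<close> over the orthogonal group
  is radial; hence, modulo radial forms, 0 lies in the convex hull of each orbit, and for large
  \<open>m\<close> the colourful Caratheodory theorem provides rotations \<open>R_j\<close> and weights \<open>t_j^d \<ge> 0\<close> for
  which the first sum is radial.
\<close>

subsection \<open>The colourful Caratheodory theorem\<close>

text \<open>Tychonoff's theorem, in the topology that the function type carries. It supplies
  compactness for choices of points, for weights, for matrices and for tensors alike.\<close>

lemma compact_Pi_UNIV:
  fixes C :: "'a \<Rightarrow> 'b::topological_space set"
  assumes "\<And>i. compact (C i)"
  shows "compact {f. \<forall>i. f i \<in> C i}"
proof -
  have "compactin (product_topology (\<lambda>i::'a. euclidean) UNIV) (PiE UNIV C)"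
    using assms by (subst compactin_PiE) auto
  moreover have "PiE UNIV C = {f. \<forall>i. f i \<in> C i}" by (auto simp: PiE_def)
  ultimately show ?thesis by (simp add: euclidean_product_topology)
qed

text \<open>Gaussian elimination: a pivot \<open>j0\<close> removes one unknown together with
  equation \<open>i\<close>, so unknowns still outnumber equations.\<close>

lemma homogeneous_system_nontrivial:
  fixes a :: "'j \<Rightarrow> 'i \<Rightarrow> real"
  assumes "finite I" "finite J" "card I < card J"
  shows "\<exists>\<mu>. (\<exists>j\<in>J. \<mu> j \<noteq> 0) \<and> (\<forall>i\<in>I. (\<Sum>j\<in>J. \<mu> j * a j i) = 0)"
  using assms
proof (induction I arbitrary: J a rule: finite_induct)
  case empty
  then show ?case by (intro exI[of _ "\<lambda>_. 1"]) (auto simp: card_gt_0_iff)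
next
  case (insert i I)
  show ?case
  proof (cases "\<forall>j\<in>J. a j i = 0")
    case True
    obtain \<mu> where "\<exists>j\<in>J. \<mu> j \<noteq> 0" "\<forall>i\<in>I. (\<Sum>j\<in>J. \<mu> j * a j i) = 0"
      using insert.IH[of J a] insert.prems insert.hyps by auto
    then show ?thesis using True by (intro exI[of _ \<mu>]) auto
  next
    case False
    then obtain j0 where j0: "j0 \<in> J" "a j0 i \<noteq> 0" by blast
    define b where "b j r = a j r - a j i / a j0 i * a j0 r" for j r
    obtain \<mu> where mu: "\<exists>j\<in>J - {j0}. \<mu> j \<noteq> 0"
        "\<forall>r\<in>I. (\<Sum>j\<in>J - {j0}. \<mu> j * b j r) = 0"
    proof -
      have "card I < card (J - {j0})" using insert.prems insert.hyps j0 by simp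
      then show ?thesis using insert.IH[of "J - {j0}" b] insert.prems that by (auto simp del: card_Diff_singleton)
    qed
    \<comment> \<open>Solving equation \<open>i\<close> for the eliminated unknown gives
      \<open>- s\<close>.\<close>
    define s where "s = (\<Sum>j\<in>J - {j0}. \<mu> j * a j i) / a j0 i"
    define \<nu> where "\<nu> = \<mu>(j0 := - s)"
    have *: "(\<Sum>j\<in>J. \<nu> j * a j r) = (\<Sum>j\<in>J - {j0}. \<mu> j * a j r) - s * a j0 r" for r
    proof -
      have "(\<Sum>j\<in>J. \<nu> j * a j r) = \<nu> j0 * a j0 r + (\<Sum>j\<in>J - {j0}. \<nu> j * a j r)"
        using insert.prems j0 by (intro sum.remove) auto
      moreover have "(\<Sum>j\<in>J - {j0}. \<nu> j * a j r) = (\<Sum>j\<in>J - {j0}. \<mu> j * a j r)"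
        by (rule sum.cong) (auto simp: \<nu>_def)
      ultimately show ?thesis by (simp add: \<nu>_def)
    qed
    have "(\<Sum>j\<in>J. \<nu> j * a j i) = 0" unfolding * by (simp add: s_def j0)
    moreover have "(\<Sum>j\<in>J. \<nu> j * a j r) = 0" if "r \<in> I" for r
    proof -
      have "(\<Sum>j\<in>J - {j0}. \<mu> j * b j r) = (\<Sum>j\<in>J - {j0}. \<mu> j * a j r) - s * a j0 r"
        by (simp add: b_def s_def sum_subtractf sum_distrib_right sum_divide_distrib right_diff_distrib
          mult.assoc mult.left_commute)
      then show ?thesis using mu that * by simp
    qed
    moreover have "\<exists>j\<in>J. \<nu> j \<noteq> 0" using mu by (auto simp: \<nu>_def)
    ultimately show ?thesis by (intro exI[of _ \<nu>]) auto
  qed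
qed

text \<open>The dimension is \<open>card I\<close> for a variable set \<open>I\<close>, so vectors
  are functions of which only the entries in \<open>I\<close> count; \<open>ip\<close> is definite
  only up to values off \<open>I\<close>.\<close>

definition ip :: "'i set \<Rightarrow> ('i \<Rightarrow> real) \<Rightarrow> ('i \<Rightarrow> real) \<Rightarrow> real" where
  "ip I p c = (\<Sum>i\<in>I. p i * c i)"

lemma ip_add_right: "ip I p (\<lambda>i. a i + b i) = ip I p a + ip I p b"
  by (simp add: ip_def algebra_simps sum.distrib)

lemma ip_diff_right: "ip I p (\<lambda>i. a i - b i) = ip I p a - ip I p b"
  by (simp add: ip_def algebra_simps sum_subtractf)

lemma ip_scale_right: "ip I p (\<lambda>i. s * a i) = s * ip I p a"
  by (simp add: ip_def algebra_simps sum_distrib_left)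

lemma ip_sum_right: "ip I p (\<lambda>i. \<Sum>j\<in>J. a j i) = (\<Sum>j\<in>J. ip I p (a j))"
  unfolding ip_def sum_distrib_left by (rule sum.swap)

lemma ip_self_nonneg: "0 \<le> ip I p p"
  by (simp add: ip_def sum_nonneg)

lemma ip_self_eq_0: "finite I \<Longrightarrow> ip I p p = 0 \<longleftrightarrow> (\<forall>i\<in>I. p i = 0)"
  by (simp add: ip_def sum_nonneg_eq_0_iff)

lemma continuous_on_ip [continuous_intros]:
  assumes "\<And>i. continuous_on S (\<lambda>x. f x i)" "\<And>i. continuous_on S (\<lambda>x. g x i)"
  shows "continuous_on S (\<lambda>x. ip I (f x) (g x))"
  unfolding ip_def by (intro continuous_intros assms)

text \<open>On the segment from \<open>p\<close> to \<open>c\<close> the squared norm is a quadratic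
  in \<open>s\<close> with derivative \<open>- 2 * D\<close> at 0, where \<open>D > 0\<close>. It
  stays below its initial value as long as \<open>s * q\<close> is at most \<open>D\<close>.\<close>

lemma ip_step_decreases:
  fixes p c :: "'i \<Rightarrow> real"
  assumes "ip I p c < ip I p p"
  shows "\<exists>s. 0 < s \<and> s \<le> 1 \<and>
    ip I (\<lambda>i. (1 - s) * p i + s * c i) (\<lambda>i. (1 - s) * p i + s * c i) < ip I p p"
proof -
  define D where "D = ip I p p - ip I p c"
  define q where "q = ip I (\<lambda>i. c i - p i) (\<lambda>i. c i - p i)"
  have D: "D > 0" using assms by (simp add: D_def)
  have q: "q \<ge> 0" unfolding q_def by (rule ip_self_nonneg)
  have expand: "ip I (\<lambda>i. (1 - s) * p i + s * c i) (\<lambda>i. (1 - s) * p i + s * c i)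
      = ip I p p - 2 * s * D + s\<^sup>2 * q" for s
    unfolding q_def D_def ip_def power2_eq_square sum_subtractf[symmetric] sum_distrib_left sum.distrib[symmetric]
    by (rule sum.cong) (auto simp: algebra_simps)
  \<comment> \<open>The minimum keeps the point on the segment, and \<open>q + 1\<close> avoids a
    zero denominator.\<close>
  define s where "s = min 1 (D / (q + 1))"
  have s: "0 < s" "s \<le> 1" using D q by (auto simp: s_def)
  have "s * q \<le> D"
  proof -
    have "s * (q + 1) \<le> D / (q + 1) * (q + 1)" using q by (intro mult_right_mono) (auto simp: s_def)
    also have "\<dots> = D" using q by simp
    finally show ?thesis using s by (simp add: distrib_left)
  qed
  then have "s\<^sup>2 * q \<le> s * D" using s by (simp add: power2_eq_square mult.assoc)
  moreover have "0 < s * D" using s D by simp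
  ultimately show ?thesis using s expand[of s] by (intro exI[of _ s]) linarith
qed

text \<open>
  The \<open>card I + 1\<close> points span only \<open>card I\<close> dimensions; lying on a hyperplane off the origin, a
  linear dependency among them has coefficient sum 0 and so is an affine one.
\<close>

lemma exists_vanishing_weight:
  fixes c :: "nat \<Rightarrow> 'i \<Rightarrow> real"
  assumes I: "finite I" and p: "ip I p p > 0"
    and c: "\<And>j. j \<le> card I \<Longrightarrow> ip I p (c j) = ip I p p"
    and l: "\<And>j. j \<le> card I \<Longrightarrow> l j > (0::real)"
    and pl: "\<And>i. i \<in> I \<Longrightarrow> p i = (\<Sum>j\<le>card I. l j * c j i)"
  shows "\<exists>l'. (\<forall>j\<le>card I. 0 \<le> l' j) \<and> (\<Sum>j\<le>card I. l' j) = (\<Sum>j\<le>card I. l j) \<and>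
     (\<forall>i\<in>I. p i = (\<Sum>j\<le>card I. l' j * c j i)) \<and> (\<exists>j\<le>card I. l' j = 0)"
proof -
  define J where "J = {..card I}"
  obtain \<mu>0 where m0: "\<exists>j\<in>J. \<mu>0 j \<noteq> 0" "\<forall>i\<in>I. (\<Sum>j\<in>J. \<mu>0 j * c j i) = 0"
    using homogeneous_system_nontrivial[of I J c] I unfolding J_def by auto
  have "0 = ip I p (\<lambda>i. \<Sum>j\<in>J. \<mu>0 j * c j i)" using m0 by (simp add: ip_def)
  also have "\<dots> = (\<Sum>j\<in>J. \<mu>0 j * ip I p (c j))" by (simp add: ip_sum_right ip_scale_right)
  also have "\<dots> = (\<Sum>j\<in>J. \<mu>0 j) * ip I p p"
    by (simp add: c J_def sum_distrib_right)
  finally have s0: "(\<Sum>j\<in>J. \<mu>0 j) = 0" using p by simp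
  have "\<exists>j\<in>J. \<mu>0 j < 0"
  proof (rule ccontr)
    assume "\<not> ?thesis"
    then have "\<forall>j\<in>J. 0 \<le> \<mu>0 j" by auto
    then have "\<forall>j\<in>J. \<mu>0 j = 0" using s0 sum_nonneg_eq_0_iff[of J \<mu>0] by (auto simp: J_def)
    then show False using m0 by auto
  qed
  then obtain j1 where j1: "j1 \<in> J" "\<mu>0 j1 < 0" by blast
  define P where "P = {j\<in>J. \<mu>0 j < 0}"
  have P: "finite P" "P \<noteq> {}" using j1 by (auto simp: P_def J_def)
  \<comment> \<open>The longest move of the weights along the dependency that keeps them
    nonnegative; a weight attaining the minimum becomes 0.\<close>
  define s where "s = Min ((\<lambda>j. l j / - \<mu>0 j) ` P)"
  obtain j2 where j2: "j2 \<in> P" "s = l j2 / - \<mu>0 j2"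
  proof -
    have "s \<in> (\<lambda>j. l j / - \<mu>0 j) ` P" unfolding s_def using P by (intro Min_in) auto
    then show ?thesis using that by blast
  qed
  have s_le: "s \<le> l j / - \<mu>0 j" if "j \<in> P" for j
    unfolding s_def using P that by (intro Min_le) auto
  have s_pos: "s > 0"
    unfolding j2(2) using j2(1) l by (intro divide_pos_pos) (auto simp: P_def J_def)
  have "0 \<le> l j + s * \<mu>0 j" if "j \<in> J" for j
  proof (cases "\<mu>0 j < 0")
    case True
    then have "s * - \<mu>0 j \<le> l j" using s_le[of j] that by (simp add: P_def field_simps)
    then show ?thesis by simp
  next
    case False
    then show ?thesis using l[of j] that s_pos by (simp add: J_def)
  qed
  moreover have "l j2 + s * \<mu>0 j2 = 0" using j2 by (simp add: P_def)
  moreover have "(\<Sum>j\<in>J. l j + s * \<mu>0 j) = (\<Sum>j\<in>J. l j)"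
    using s0 by (simp add: sum.distrib sum_distrib_left[symmetric])
  moreover have "(\<Sum>j\<in>J. (l j + s * \<mu>0 j) * c j i) = p i" if "i \<in> I" for i
  proof -
    have "(\<Sum>j\<in>J. (l j + s * \<mu>0 j) * c j i) = (\<Sum>j\<in>J. l j * c j i) + s * (\<Sum>j\<in>J. \<mu>0 j * c j i)"
      by (simp add: algebra_simps sum.distrib sum_distrib_left)
    then show ?thesis using pl that m0 by (simp add: J_def)
  qed
  moreover have "j2 \<in> J" using j2 by (simp add: P_def)
  ultimately show ?thesis unfolding J_def
    by (intro exI[of _ "\<lambda>j. l j + s * \<mu>0 j"]) auto
qed

text \<open>
  The hypothesis \<open>dir\<close> says that 0 lies in the closed convex hull of every colour class. A point
  of minimal norm in a rainbow simplex can be written without one of the colours, and exchanging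
  the point of that colour would bring it closer to 0.
\<close>

lemma colourful_Caratheodory:
  fixes C :: "nat \<Rightarrow> ('i \<Rightarrow> real) set"
  assumes I: "finite I" and C: "\<And>j. compact (C j)" "\<And>j. C j \<noteq> {}"
    and dir: "\<And>j p. ip I p p > 0 \<Longrightarrow> \<exists>c\<in>C j. ip I p c < ip I p p"
  shows "\<exists>c l. (\<forall>j. c j \<in> C j) \<and> (\<forall>j\<le>card I. 0 \<le> l j) \<and> (\<Sum>j\<le>card I. l j) = (1::real) \<and>
     (\<forall>i\<in>I. (\<Sum>j\<le>card I. l j * c j i) = 0)"
proof -
  define J where "J = {..card I}"
  define A where "A = {c. \<forall>j. c j \<in> C j}"
  \<comment> \<open>Weights with index outside \<open>J\<close> never enter \<open>pt\<close>, but
    they too must be bounded for \<open>B\<close> to be compact.\<close>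
  define B where "B = {l. \<forall>j::nat. l j \<in> {0..1::real}} \<inter> {l. (\<Sum>j\<in>J. l j) = 1}"
  define pt where "pt x = (\<lambda>i. \<Sum>j\<in>J. snd x j * fst x j i)" for x :: "(nat \<Rightarrow> 'i \<Rightarrow> real) \<times> (nat \<Rightarrow> real)"
  have cA: "compact A" unfolding A_def by (rule compact_Pi_UNIV) (rule C)
  have "closed {l::nat\<Rightarrow>real. (\<Sum>j\<in>J. l j) = 1}"
    by (intro closed_Collect_eq continuous_intros continuous_on_product_coordinates)
  then have cB: "compact B" unfolding B_def
    by (intro compact_Int_closed compact_Pi_UNIV) auto
  have ne: "A \<times> B \<noteq> {}"
  proof -
    have "(\<lambda>j. SOME c. c \<in> C j) \<in> A" using C(2) by (auto simp: A_def some_in_eq)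
    moreover have "(\<lambda>j. if j = 0 then 1 else 0) \<in> B" by (auto simp: B_def J_def)
    ultimately show ?thesis by blast
  qed
  have f1: "continuous_on (A \<times> B) (\<lambda>x. fst x j i)" for j i
    by (rule continuous_on_product_then_coordinatewise[OF
      continuous_on_product_then_coordinatewise[OF continuous_on_fst[OF continuous_on_id]]])
  have f2: "continuous_on (A \<times> B) (\<lambda>x. snd x j)" for j
    by (rule continuous_on_product_then_coordinatewise[OF continuous_on_snd[OF continuous_on_id]])
  have "continuous_on (A \<times> B) (\<lambda>x. ip I (pt x) (pt x))"
    unfolding pt_def by (intro continuous_intros f1 f2)
  from continuous_attains_inf[OF compact_Times[OF cA cB] ne this]
  obtain x0 where x0: "x0 \<in> A \<times> B" "\<And>x. x \<in> A \<times> B \<Longrightarrow> ip I (pt x0) (pt x0) \<le> ip I (pt x) (pt x)"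
    by blast
  define c l p where "c = fst x0" and "l = snd x0" and "p = pt x0"
  have cC: "\<And>j. c j \<in> C j" and lB: "l \<in> B" using x0 by (auto simp: c_def l_def A_def)
  have min: "ip I p p \<le> ip I q q"
    if "\<And>j. c' j \<in> C j" "\<And>j. j \<in> J \<Longrightarrow> 0 \<le> l' j" "(\<Sum>j\<in>J. l' j) = 1"
       "\<And>i. i \<in> I \<Longrightarrow> q i = (\<Sum>j\<in>J. l' j * c' j i)" for c' l' q
  proof -
    \<comment> \<open>Nothing is known about \<open>l'\<close> outside \<open>J\<close>; truncation
      brings it into \<open>B\<close>.\<close>
    define l'' where "l'' j = (if j \<in> J then l' j else 0)" for j
    have "l' j \<le> 1" if "j \<in> J" for j
      using member_le_sum[of j J l'] that \<open>\<And>j. j \<in> J \<Longrightarrow> 0 \<le> l' j\<close> \<open>(\<Sum>j\<in>J. l' j) = 1\<close>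
      by (auto simp: J_def)
    then have "(c', l'') \<in> A \<times> B" using that by (auto simp: A_def B_def l''_def)
    from x0(2)[OF this] have "ip I p p \<le> ip I (pt (c', l'')) (pt (c', l''))" by (simp add: p_def)
    also have "\<dots> = ip I q q" unfolding ip_def
      by (rule sum.cong) (auto simp: that pt_def l''_def)
    finally show ?thesis .
  qed
  have pe: "p i = (\<Sum>j\<in>J. l j * c j i)" for i by (simp add: p_def pt_def c_def l_def)
  have l01: "\<And>j. 0 \<le> l j" and lsum: "(\<Sum>j\<in>J. l j) = 1" using lB by (auto simp: B_def)
  have "ip I p p = 0"
  proof (rule ccontr)
    assume "ip I p p \<noteq> 0"
    then have pp: "ip I p p > 0" using ip_self_nonneg[of I p] by simp
    \<comment> \<open>If colour \<open>a\<close> has weight 0, its point may be replaced by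
      \<open>v\<close> without changing \<open>p\<close>; if \<open>v = c a\<close>, nothing is
      replaced. Either way the segment from \<open>p\<close> to \<open>v\<close> stays in a rainbow
      simplex, so \<open>ip_step_decreases\<close> contradicts minimality.\<close>
    have move: "False" if l': "\<And>j. j \<in> J \<Longrightarrow> 0 \<le> l' j" "(\<Sum>j\<in>J. l' j) = 1"
        "\<And>i. i \<in> I \<Longrightarrow> p i = (\<Sum>j\<in>J. l' j * c j i)"
      and a: "a \<in> J" "v \<in> C a" "ip I p v < ip I p p" "l' a = 0 \<or> v = c a" for l' a v
    proof -
      obtain s where s: "0 < s" "s \<le> 1"
         "ip I (\<lambda>i. (1 - s) * p i + s * v i) (\<lambda>i. (1 - s) * p i + s * v i) < ip I p p"
        using ip_step_decreases[OF a(3)] by blast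
      define c' where "c' = c(a := v)"
      define l2 where "l2 j = (1 - s) * l' j + s * (if j = a then 1 else 0)" for j
      have "ip I p p \<le> ip I (\<lambda>i. (1 - s) * p i + s * v i) (\<lambda>i. (1 - s) * p i + s * v i)"
      proof (rule min[of c' l2])
        show "\<And>j. c' j \<in> C j" using cC a by (auto simp: c'_def)
        show "\<And>j. j \<in> J \<Longrightarrow> 0 \<le> l2 j" using l' s by (auto simp: l2_def)
        show "sum l2 J = 1" using l'(2) a
          by (simp add: l2_def sum.distrib sum_distrib_left[symmetric] J_def)
        show "(1 - s) * p i + s * v i = (\<Sum>j\<in>J. l2 j * c' j i)" if "i \<in> I" for i
        proof -
          have "(\<Sum>j\<in>J. l2 j * c' j i) = (\<Sum>j\<in>J. (1 - s) * (l' j * c j i) + (if j = a then s * v i else 0))"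
            by (rule sum.cong) (use a in \<open>auto simp: l2_def c'_def algebra_simps\<close>)
          also have "\<dots> = (1 - s) * p i + s * v i"
            using a l'(3)[OF that] by (simp add: sum.distrib sum_distrib_left[symmetric] J_def)
          finally show ?thesis by simp
        qed
      qed
      then show False using s by simp
    qed
    have ge: "ip I p (c j) \<ge> ip I p p" if "j \<in> J" for j
      using move[of l j "c j"] l01 lsum pe that cC by force
    \<comment> \<open>The weighted mean of the numbers \<open>ip I p (c j)\<close> is
      \<open>ip I p p\<close>, and none is smaller. Hence every colour of positive weight lies on
      the hyperplane where equality holds.\<close>
    have "(\<Sum>j\<in>J. l j * (ip I p (c j) - ip I p p)) = ip I p (\<lambda>i. \<Sum>j\<in>J. l j * c j i) - (\<Sum>j\<in>J. l j) * ip I p p"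
      by (simp add: ip_sum_right ip_scale_right right_diff_distrib sum_subtractf sum_distrib_right)
    also have "\<dots> = 0" using lsum pe[abs_def] by (simp add: pe[symmetric])
    finally have z: "\<forall>j\<in>J. l j * (ip I p (c j) - ip I p p) = 0"
      using ge l01 by (subst (asm) sum_nonneg_eq_0_iff) (auto simp: J_def)
    obtain l' a where l': "\<And>j. j \<in> J \<Longrightarrow> 0 \<le> l' j" "(\<Sum>j\<in>J. l' j) = 1"
        "\<And>i. i \<in> I \<Longrightarrow> p i = (\<Sum>j\<in>J. l' j * c j i)" and a: "a \<in> J" "l' a = 0"
    proof (cases "\<exists>a\<in>J. l a = 0")
      case True
      then show ?thesis using that[of l] l01 lsum pe by blast
    next
      case False
      then have pos: "\<And>j. j \<in> J \<Longrightarrow> l j > 0" using l01 by (metis less_eq_real_def)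
      with z have "\<And>j. j \<in> J \<Longrightarrow> ip I p (c j) = ip I p p" by force
      then obtain l' a where *: "\<forall>j\<le>card I. 0 \<le> l' j" "(\<Sum>j\<le>card I. l' j) = (\<Sum>j\<le>card I. l j)"
          "\<forall>i\<in>I. p i = (\<Sum>j\<le>card I. l' j * c j i)" "a \<le> card I" "l' a = 0"
        using exists_vanishing_weight[OF I pp, of c l] pos pe unfolding J_def by auto
      show ?thesis
        by (rule that[of l' a]) (use * lsum in \<open>auto simp: J_def\<close>)
    qed
    obtain v where "v \<in> C a" "ip I p v < ip I p p" using dir[OF pp, of a] by blast
    then show False using move[OF l'] a by blast
  qed
  then have "\<forall>i\<in>I. p i = 0" using I by (simp add: ip_self_eq_0)
  then have "\<forall>i\<in>I. (\<Sum>j\<in>J. l j * c j i) = 0" using pe by simp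
  then show ?thesis using cC l01 lsum unfolding J_def by blast
qed

subsection \<open>The orthogonal group acting on tensors\<close>

definition words :: "nat \<Rightarrow> nat \<Rightarrow> nat list set" where
  "words k d = {l. set l \<subseteq> {..<k} \<and> length l = d}"

lemma finite_words [simp]: "finite (words k d)"
  unfolding words_def by (rule finite_lists_length_eq) simp

lemma words_0 [simp]: "words k 0 = {[]}"
  by (auto simp: words_def)

lemma Cons_in_words [simp]: "i # l \<in> words k (Suc d) \<longleftrightarrow> i < k \<and> l \<in> words k d"
  by (auto simp: words_def)

lemma words_SucE:
  assumes "l \<in> words k (Suc d)"
  obtains i l' where "l = i # l'" "i < k" "l' \<in> words k d"
  using assms by (cases l) (auto simp: words_def)

lemma sum_words_Suc: "(\<Sum>l\<in>words k (Suc d). g l) = (\<Sum>i<k. \<Sum>l\<in>words k d. g (i # l))"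
proof -
  have "(\<Sum>l\<in>words k (Suc d). g l) = (\<Sum>(i, l)\<in>{..<k} \<times> words k d. g (i # l))"
    by (rule sum.reindex_bij_witness[of _ "\<lambda>(i, l). i # l" "\<lambda>l. (hd l, tl l)"])
       (auto elim: words_SucE)
  then show ?thesis by (simp add: sum.cartesian_product)
qed

definition word_prod :: "nat list \<Rightarrow> (nat \<Rightarrow> real) \<Rightarrow> real" where
  "word_prod l x = prod_list (map x l)"

lemma word_prod_simps [simp]:
  "word_prod [] x = 1" "word_prod (i # l) x = x i * word_prod l x"
  by (simp_all add: word_prod_def)

section \<open>Matrices and their tensor powers\<close>

definition mat_vec :: "nat \<Rightarrow> (nat \<Rightarrow> nat \<Rightarrow> real) \<Rightarrow> (nat \<Rightarrow> real) \<Rightarrow> nat \<Rightarrow> real" where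
  "mat_vec k M x = (\<lambda>i. \<Sum>j<k. M i j * x j)"

definition mat_mul :: "nat \<Rightarrow> (nat \<Rightarrow> nat \<Rightarrow> real) \<Rightarrow> (nat \<Rightarrow> nat \<Rightarrow> real) \<Rightarrow> nat \<Rightarrow> nat \<Rightarrow> real" where
  "mat_mul k R S = (\<lambda>i j. \<Sum>s<k. R i s * S s j)"

definition mat_transpose :: "(nat \<Rightarrow> nat \<Rightarrow> real) \<Rightarrow> nat \<Rightarrow> nat \<Rightarrow> real" where
  "mat_transpose R = (\<lambda>i j. R j i)"

definition mat_id :: "nat \<Rightarrow> nat \<Rightarrow> nat \<Rightarrow> real" where
  "mat_id k = (\<lambda>i j. if i = j \<and> i < k then 1 else 0)"

lemma mat_mul_assoc: "mat_mul m (mat_mul k A B) C = mat_mul k A (mat_mul m B C)"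
  unfolding mat_mul_def sum_distrib_left sum_distrib_right
  by (subst sum.swap) (simp add: mult.assoc)

lemma mat_vec_mat_mul: "mat_vec k (mat_mul m A B) x = mat_vec m A (mat_vec k B x)"
  unfolding mat_vec_def mat_mul_def sum_distrib_left sum_distrib_right
  by (subst sum.swap) (simp add: mult.assoc)

lemma mat_transpose_mul:
  "mat_transpose (mat_mul k A B) = mat_mul k (mat_transpose B) (mat_transpose A)"
  by (simp add: mat_transpose_def mat_mul_def mult.commute)

lemma mat_transpose_transpose [simp]: "mat_transpose (mat_transpose A) = A"
  by (simp add: mat_transpose_def)

lemma mat_mul_id:
  assumes "\<And>i j. i \<ge> k \<or> j \<ge> k \<Longrightarrow> A i j = 0"
  shows "mat_mul k A (mat_id k) = A" "mat_mul k (mat_id k) A = A"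
proof -
  have "mat_mul k A (mat_id k) i j = A i j" for i j
  proof (cases "j < k")
    case True
    have "mat_mul k A (mat_id k) i j = (\<Sum>s<k. if s = j then A i j else 0)"
      unfolding mat_mul_def by (rule sum.cong) (auto simp: mat_id_def)
    then show ?thesis using True by simp
  qed (use assms in \<open>auto simp: mat_mul_def mat_id_def\<close>)
  moreover have "mat_mul k (mat_id k) A i j = A i j" for i j
  proof (cases "i < k")
    case True
    have "mat_mul k (mat_id k) A i j = (\<Sum>s<k. if s = i then A i j else 0)"
      unfolding mat_mul_def by (rule sum.cong) (auto simp: mat_id_def)
    then show ?thesis using True by simp
  qed (use assms in \<open>auto simp: mat_mul_def mat_id_def\<close>)
  ultimately show "mat_mul k A (mat_id k) = A" "mat_mul k (mat_id k) A = A"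
    by (simp_all add: fun_eq_iff)
qed

text \<open>
  Forms of degree \<open>d\<close> are represented by arbitrary, not necessarily symmetric, tensors: on these
  the orthogonal group acts by isometries of the plain Euclidean norm.
\<close>

fun kron :: "(nat \<Rightarrow> nat \<Rightarrow> real) \<Rightarrow> nat list \<Rightarrow> nat list \<Rightarrow> real" where
  "kron R (i # l) (j # m) = R i j * kron R l m"
| "kron R _ _ = 1"

text \<open>\<open>kron R\<close> is a tensor power of \<open>R\<close>, hence multiplicative:
  splitting off the first letter factors the sum into an entry of \<open>mat_mul k R S\<close> and
  the same sum for shorter words.\<close>

lemma kron_mat_mul:
  "l \<in> words m d \<Longrightarrow> l'' \<in> words n d \<Longrightarrow>
    (\<Sum>l'\<in>words k d. kron R l l' * kron S l' l'') = kron (mat_mul k R S) l l''"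
proof (induction d arbitrary: l l'')
  case 0
  then show ?case by simp
next
  case (Suc d)
  obtain a as b bs where l: "l = a # as" "as \<in> words m d" "l'' = b # bs" "bs \<in> words n d"
    using Suc.prems by (auto elim!: words_SucE)
  have "(\<Sum>l'\<in>words k (Suc d). kron R l l' * kron S l' l'')
      = (\<Sum>i<k. \<Sum>l'\<in>words k d. (R a i * S i b) * (kron R as l' * kron S l' bs))"
    by (simp add: sum_words_Suc l mult_ac)
  also have "\<dots> = mat_mul k R S a b * kron (mat_mul k R S) as bs"
    unfolding sum_product[symmetric] using Suc.IH l by (simp add: mat_mul_def)
  finally show ?case by (simp add: l)
qed

lemma kron_mat_id:
  "l \<in> words k d \<Longrightarrow> l' \<in> words k d \<Longrightarrow> kron (mat_id k) l l' = (if l = l' then 1 else 0)"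
proof (induction d arbitrary: l l')
  case (Suc d)
  then obtain a as b bs where l: "l = a # as" "a < k" "as \<in> words k d" "l' = b # bs" "bs \<in> words k d"
    by (auto elim!: words_SucE)
  have "kron (mat_id k) l l' = mat_id k a b * (if as = bs then 1 else 0)"
    using Suc.IH[OF l(3,5)] by (simp add: l(1,4))
  also have "\<dots> = (if l = l' then 1 else 0)" using l by (simp add: mat_id_def)
  finally show ?case .
qed simp

lemma kron_transpose: "kron (mat_transpose R) l l' = kron R l' l"
  by (induction R l l' rule: kron.induct) (auto simp: mat_transpose_def split: list.split elim: kron.elims)

text \<open>The numbers \<open>word_prod l x\<close> are the entries of the tensor power of
  \<open>x\<close>, so substituting \<open>M x\<close> multiplies by the tensor power of
  \<open>M\<close>.\<close>

lemma word_prod_mat_vec: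
  "length l = d \<Longrightarrow> word_prod l (mat_vec k M x) = (\<Sum>l'\<in>words k d. kron M l l' * word_prod l' x)"
proof (induction d arbitrary: l)
  case 0
  then show ?case by simp
next
  case (Suc d)
  obtain a as where l: "l = a # as" "length as = d" using Suc.prems by (cases l) auto
  have "(\<Sum>l'\<in>words k (Suc d). kron M l l' * word_prod l' x)
      = (\<Sum>i<k. \<Sum>l'\<in>words k d. (M a i * x i) * (kron M as l' * word_prod l' x))"
    by (simp add: sum_words_Suc l mult_ac)
  also have "\<dots> = mat_vec k M x a * word_prod as (mat_vec k M x)"
    unfolding sum_product[symmetric] using Suc.IH l by (simp add: mat_vec_def)
  finally show ?case by (simp add: l)
qed

text \<open>The value 0 off \<open>words k d\<close> lets invariance of a tensor be stated as an
  equality of functions.\<close>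

definition act :: "nat \<Rightarrow> nat \<Rightarrow> (nat \<Rightarrow> nat \<Rightarrow> real) \<Rightarrow> (nat list \<Rightarrow> real) \<Rightarrow> nat list \<Rightarrow> real" where
  "act k d R T = (\<lambda>l. if l \<in> words k d then \<Sum>l'\<in>words k d. kron R l l' * T l' else 0)"

lemma act_act: "act k d R (act k d S T) = act k d (mat_mul k R S) T"
proof -
  have "(\<Sum>l'\<in>words k d. kron R l l' * (\<Sum>m\<in>words k d. kron S l' m * T m))
     = (\<Sum>m\<in>words k d. kron (mat_mul k R S) l m * T m)" if "l \<in> words k d" for l
  proof -
    have "(\<Sum>l'\<in>words k d. kron R l l' * (\<Sum>m\<in>words k d. kron S l' m * T m))
       = (\<Sum>m\<in>words k d. (\<Sum>l'\<in>words k d. kron R l l' * kron S l' m) * T m)"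
      unfolding sum_distrib_left sum_distrib_right by (subst sum.swap) (simp add: mult.assoc)
    then show ?thesis using that by (simp add: kron_mat_mul cong: sum.cong)
  qed
  then show ?thesis by (auto simp: act_def fun_eq_iff cong: sum.cong)
qed

lemma act_id: "l \<in> words k d \<Longrightarrow> act k d (mat_id k) T l = T l"
  by (simp add: act_def kron_mat_id if_distrib[of "\<lambda>x. x * _"] cong: sum.cong if_cong)

lemma act_outside: "l \<notin> words k d \<Longrightarrow> act k d R T l = 0"
  by (simp add: act_def)

lemma act_diff: "act k d R (\<lambda>l. S l - T l) l = act k d R S l - act k d R T l"
  by (simp add: act_def right_diff_distrib sum_subtractf)

text \<open>The transpose acts as the adjoint. For orthogonal matrices this gives both the
  invariance of the norm and the transfer of a rotation from a tensor to a linear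
  functional.\<close>

lemma ip_act_transpose: "ip (words k d) (act k d R p) S = ip (words k d) p (act k d (mat_transpose R) S)"
  unfolding ip_def act_def
  by (simp add: kron_transpose sum_distrib_left sum_distrib_right mult_ac) (subst sum.swap, simp add: mult_ac)

definition form :: "nat \<Rightarrow> nat \<Rightarrow> (nat list \<Rightarrow> real) \<Rightarrow> (nat \<Rightarrow> real) \<Rightarrow> real" where
  "form k d T x = (\<Sum>l\<in>words k d. T l * word_prod l x)"

lemma form_act: "form k d (act k d R T) x = form k d T (mat_vec k (mat_transpose R) x)"
proof -
  have "form k d T (mat_vec k (mat_transpose R) x)
      = (\<Sum>l\<in>words k d. T l * (\<Sum>l'\<in>words k d. kron R l' l * word_prod l' x))"
    unfolding form_def
    by (rule sum.cong) (auto simp: words_def word_prod_mat_vec kron_transpose)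
  also have "\<dots> = form k d (act k d R T) x"
    unfolding form_def act_def
    by (simp add: sum_distrib_left sum_distrib_right mult_ac) (subst sum.swap, simp add: mult_ac)
  finally show ?thesis by simp
qed

section \<open>The orthogonal group: compactness and transitivity on spheres\<close>

definition orth :: "nat \<Rightarrow> (nat \<Rightarrow> nat \<Rightarrow> real) set" where
  "orth k = {R. (\<forall>i j. i \<ge> k \<or> j \<ge> k \<longrightarrow> R i j = 0) \<and>
     mat_mul k R (mat_transpose R) = mat_id k \<and> mat_mul k (mat_transpose R) R = mat_id k}"

lemma orth_id: "mat_id k \<in> orth k"
proof -
  have "mat_transpose (mat_id k) = mat_id k" by (auto simp: mat_transpose_def mat_id_def fun_eq_iff)
  moreover have "mat_mul k (mat_id k) (mat_id k) = mat_id k"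
    by (rule mat_mul_id) (auto simp: mat_id_def)
  ultimately show ?thesis by (auto simp: orth_def) (auto simp: mat_id_def)
qed

lemma orth_transpose: "R \<in> orth k \<Longrightarrow> mat_transpose R \<in> orth k"
  by (auto simp: orth_def) (auto simp: mat_transpose_def)

lemma orth_mul:
  assumes "R \<in> orth k" "S \<in> orth k"
  shows "mat_mul k R S \<in> orth k"
proof -
  have R: "\<And>i j. i \<ge> k \<or> j \<ge> k \<Longrightarrow> R i j = 0" and S: "\<And>i j. i \<ge> k \<or> j \<ge> k \<Longrightarrow> S i j = 0"
    using assms by (auto simp: orth_def)
  have St: "\<And>i j. i \<ge> k \<or> j \<ge> k \<Longrightarrow> mat_transpose S i j = 0" using S by (auto simp: mat_transpose_def)
  have Rt: "\<And>i j. i \<ge> k \<or> j \<ge> k \<Longrightarrow> mat_transpose R i j = 0" using R by (auto simp: mat_transpose_def)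
  have "mat_mul k (mat_mul k R S) (mat_transpose (mat_mul k R S))
     = mat_mul k R (mat_mul k (mat_mul k S (mat_transpose S)) (mat_transpose R))"
    by (simp add: mat_transpose_mul mat_mul_assoc)
  also have "\<dots> = mat_id k" using assms mat_mul_id(2)[of k "mat_transpose R", OF Rt] by (simp add: orth_def)
  finally have 1: "mat_mul k (mat_mul k R S) (mat_transpose (mat_mul k R S)) = mat_id k" .
  have "mat_mul k (mat_transpose (mat_mul k R S)) (mat_mul k R S)
     = mat_mul k (mat_transpose S) (mat_mul k (mat_mul k (mat_transpose R) R) S)"
    by (simp add: mat_transpose_mul mat_mul_assoc)
  also have "\<dots> = mat_id k" using assms mat_mul_id(2)[of k S, OF S] by (simp add: orth_def)
  finally have 2: "mat_mul k (mat_transpose (mat_mul k R S)) (mat_mul k R S) = mat_id k" .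
  have "\<forall>i j. i \<ge> k \<or> j \<ge> k \<longrightarrow> mat_mul k R S i j = 0"
    using R S by (auto simp: mat_mul_def)
  with 1 2 show ?thesis by (simp add: orth_def)
qed

text \<open>Closed because it is cut out by polynomial equations in the entries; bounded because the
  rows are unit vectors.\<close>

lemma compact_orth: "compact (orth k)"
proof -
  have c: "continuous_on UNIV (\<lambda>R. R i j)" for i j :: nat
    by (rule continuous_on_product_then_coordinatewise[OF
      continuous_on_product_then_coordinatewise[OF continuous_on_id]])
  \<comment> \<open>The 0-1 factor turns the conditional vanishing of entries into an equation, to
    which the closedness rules apply.\<close>
  have "orth k = {R. \<forall>i j. R i j * (if i \<ge> k \<or> j \<ge> k then 1 else 0) = 0 \<and>
     (\<Sum>s<k. R i s * R j s) = mat_id k i j \<and> (\<Sum>s<k. R s i * R s j) = mat_id k i j}"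
    by (auto simp: orth_def fun_eq_iff mat_mul_def mat_transpose_def)
  also have "closed \<dots>"
    by (intro closed_Collect_all closed_Collect_conj closed_Collect_eq continuous_intros c)
  finally have "closed (orth k)" .
  moreover have "compact {R. \<forall>i. R i \<in> {r. \<forall>j. r j \<in> {-1..1::real}}}"
    by (intro compact_Pi_UNIV) auto
  moreover have "orth k \<subseteq> {R. \<forall>i. R i \<in> {r. \<forall>j. r j \<in> {-1..1::real}}}"
  proof -
    have "R i j \<in> {-1..1}" if R: "R \<in> orth k" for R i j
    proof (cases "i < k \<and> j < k")
      case True
      have "mat_mul k R (mat_transpose R) i i = 1" using R True by (simp add: orth_def mat_id_def)
      then have "(\<Sum>s<k. (R i s)\<^sup>2) = 1" by (simp add: mat_mul_def mat_transpose_def power2_eq_square)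
      moreover have "(R i j)\<^sup>2 \<le> (\<Sum>s<k. (R i s)\<^sup>2)" using True by (intro member_le_sum) auto
      ultimately have "\<bar>R i j\<bar> \<le> 1" by (simp add: abs_square_le_1)
      then show ?thesis by auto
    next
      case False
      then have "R i j = 0" using R by (auto simp: orth_def not_less)
      then show ?thesis by simp
    qed
    then show ?thesis by blast
  qed
  ultimately show ?thesis
    by (metis compact_Int_closed inf.absorb_iff2)
qed

text \<open>Unless \<open>x\<close> and \<open>y\<close> agree below \<open>k\<close>, the
  Householder reflection along \<open>x - y\<close> takes \<open>x\<close> to
  \<open>y\<close>.\<close>

lemma orth_transitive:
  assumes "std_quad k x = std_quad k y"
  shows "\<exists>R\<in>orth k. \<forall>i<k. mat_vec k R x i = y i"
proof (cases "\<forall>i<k. x i = y i")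
  case True
  then show ?thesis using orth_id
    by (intro bexI[of _ "mat_id k"])
       (auto simp: mat_vec_def mat_id_def if_distrib[of "\<lambda>x. x * _"] cong: if_cong)
next
  case False
  define v where "v i = x i - y i" for i
  define N where "N = (\<Sum>i<k. (v i)\<^sup>2)"
  have "N \<noteq> 0" using False unfolding N_def by (subst sum_nonneg_eq_0_iff) (auto simp: v_def)
  define R where "R i j = (if i < k \<and> j < k then (if i = j then 1 else 0) - 2 * v i * v j / N else 0)" for i j
  have "R \<in> orth k"
  proof -
    have Rt: "mat_transpose R = R" by (auto simp: mat_transpose_def R_def fun_eq_iff)
    have RR: "mat_mul k R R i j = mat_id k i j" for i j
    proof (cases "i < k \<and> j < k")
      case True
      have "mat_mul k R R i j = (\<Sum>s<k. (if s = i then (if i = j then 1 else 0) - 2 * v i * v j / N else 0)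
          - (if s = j then 2 * v i * v j / N else 0) + 4 * v i * v j / N\<^sup>2 * (v s)\<^sup>2)"
        unfolding mat_mul_def
        by (rule sum.cong) (use True \<open>N \<noteq> 0\<close> in \<open>auto simp: R_def field_simps power2_eq_square\<close>)
      also have "\<dots> = (if i = j then 1 else 0) - 4 * v i * v j / N + 4 * v i * v j / N\<^sup>2 * N"
        using True unfolding sum.distrib sum_subtractf sum_distrib_left[symmetric] N_def[symmetric]
        by auto
      also have "\<dots> = mat_id k i j"
        using \<open>N \<noteq> 0\<close> True by (simp add: mat_id_def power2_eq_square)
      finally show ?thesis .
    next
      case False
      then show ?thesis by (auto simp: mat_mul_def R_def mat_id_def)
    qed
    from RR have "mat_mul k R R = mat_id k" by (simp add: fun_eq_iff)
    with Rt show ?thesis by (simp add: orth_def) (simp add: R_def)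
  qed
  moreover have "mat_vec k R x i = y i" if i: "i < k" for i
  proof -
    \<comment> \<open>Only here do the equal norms enter: they make the reflection subtract exactly
      \<open>v\<close> from \<open>x\<close>.\<close>
    have "2 * (\<Sum>j<k. v j * x j) = (\<Sum>j<k. (v j)\<^sup>2 + (x j)\<^sup>2 - (y j)\<^sup>2)"
      unfolding sum_distrib_left by (rule sum.cong) (auto simp: v_def power2_eq_square algebra_simps)
    also have "\<dots> = N" using assms by (simp add: sum.distrib sum_subtractf N_def std_quad_def)
    finally have *: "2 * (\<Sum>j<k. v j * x j) = N" .
    have "mat_vec k R x i = (\<Sum>j<k. (if i = j then x i else 0) - v i / N * (2 * (v j * x j)))"
      unfolding mat_vec_def
      by (rule sum.cong) (use i in \<open>auto simp: R_def algebra_simps\<close>)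
    also have "\<dots> = x i - v i / N * (2 * (\<Sum>j<k. v j * x j))"
      using i by (simp add: sum_subtractf sum_distrib_left)
    also have "\<dots> = y i" using * \<open>N \<noteq> 0\<close> by (simp add: v_def)
    finally show ?thesis .
  qed
  ultimately show ?thesis by blast
qed

lemma continuous_on_act:
  "continuous_on S (\<lambda>R. act k d R T)"
proof -
  have c: "continuous_on S (\<lambda>R. R i j)" for i j :: nat
    by (rule continuous_on_product_then_coordinatewise[OF
      continuous_on_product_then_coordinatewise[OF continuous_on_id]])
  have "continuous_on S (\<lambda>R. kron R l l')" for l l'
    by (induction l l' rule: list_induct2') (auto intro!: continuous_intros c)
  then show ?thesis unfolding act_def
    by (intro continuous_on_coordinatewise_then_product, case_tac "i \<in> words k d")
       (auto intro!: continuous_intros)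
qed

text \<open>
  In place of Haar averaging, \<open>q\<close> is the point of minimal norm in the closed convex hull of the
  orbit of \<open>T\<close>, which is invariant because it is unique.
\<close>

lemma orbit_centre:
  fixes k d :: nat and T :: "nat list \<Rightarrow> real"
  defines "W \<equiv> words k d"
  shows "\<exists>q. (\<forall>R\<in>orth k. act k d R q = q) \<and>
     (\<forall>p. ip W p p > 0 \<longrightarrow> (\<exists>R\<in>orth k. ip W p (act k d R (\<lambda>l. T l - q l)) < ip W p p))"
proof -
  \<comment> \<open>The closed convex hull of the orbit, described as the intersection of the
    half-spaces containing it; closedness, convexity and invariance can then be read off.\<close>
  define K where "K = {S. (\<forall>l. l \<notin> W \<longrightarrow> S l = 0) \<and>
     (\<forall>p c. (\<forall>R\<in>orth k. c \<le> ip W p (act k d R T)) \<longrightarrow> c \<le> ip W p S)}"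
  have W: "finite W" by (simp add: W_def)
  \<comment> \<open>\<open>T\<close> itself may be nonzero off \<open>W\<close>; the identity acts
    by cutting it down to \<open>W\<close>.\<close>
  have T0: "act k d (mat_id k) T \<in> K" using orth_id by (auto simp: K_def act_outside W_def)
  have act_K: "act k d R S \<in> K" if S: "S \<in> K" and R: "R \<in> orth k" for R S
  proof -
    have "c \<le> ip W p (act k d R S)" if c: "\<forall>R\<in>orth k. c \<le> ip W p (act k d R T)" for p c
    proof -
      have "c \<le> ip W (act k d (mat_transpose R) p) (act k d R' T)" if "R' \<in> orth k" for R'
        using c orth_mul[OF R that] unfolding W_def ip_act_transpose by (simp add: act_act)
      then have "c \<le> ip W (act k d (mat_transpose R) p) S" using S by (auto simp: K_def)
      then show ?thesis unfolding W_def ip_act_transpose by simp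
    qed
    then show ?thesis by (auto simp: K_def act_outside W_def)
  qed
  have ip_act: "ip W (act k d R S) (act k d R S) = ip W S S" if R: "R \<in> orth k" for R S
  proof -
    have "ip W (act k d R S) (act k d R S) = ip W S (act k d (mat_id k) S)"
      using R unfolding W_def ip_act_transpose by (simp add: act_act orth_def)
    also have "\<dots> = ip W S S" unfolding ip_def by (rule sum.cong) (auto simp: W_def act_id)
    finally show ?thesis .
  qed
  \<comment> \<open>Adding 1 makes the square of \<open>B\<close> exceed \<open>ip W T T\<close>, so
    no square root is needed for a bound on the entries.\<close>
  define B where "B = ip W T T + 1"
  have B: "B \<ge> 1" "ip W T T < B\<^sup>2"
  proof -
    show "B \<ge> 1" using ip_self_nonneg[of W T] by (simp add: B_def)
    then have "B * 1 \<le> B * B" by (intro mult_left_mono) auto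
    then show "ip W T T < B\<^sup>2" by (simp add: B_def power2_eq_square)
  qed
  have box: "\<bar>S l\<bar> \<le> B" if "S \<in> K" "ip W S S \<le> ip W T T" for S l
  proof (cases "l \<in> W")
    case True
    have "(S l)\<^sup>2 \<le> (\<Sum>l\<in>W. (S l)\<^sup>2)" using True W by (intro member_le_sum) auto
    also have "\<dots> \<le> B\<^sup>2" using that B by (simp add: ip_def power2_eq_square)
    finally show ?thesis using B by (simp add: abs_le_square_iff[symmetric])
  next
    case False
    then show ?thesis using that B by (auto simp: K_def)
  qed
  \<comment> \<open>The box supplies compactness and, by \<open>box\<close>, contains every point of
    \<open>K\<close> whose norm is at most that of \<open>T\<close>; so a minimum over
    \<open>K'\<close> is one over \<open>K\<close>.\<close>
  define K' where "K' = {S. \<forall>l. S l \<in> {-B..B}} \<inter> K"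
  have c: "continuous_on UNIV (\<lambda>S::nat list \<Rightarrow> real. S l)" for l by simp
  have "K = {S. \<forall>l. S l * (if l \<in> W then 0 else 1) = 0} \<inter>
      (\<Inter>p. \<Inter>c\<in>{c. \<forall>R\<in>orth k. c \<le> ip W p (act k d R T)}. {S. c \<le> ip W p S})"
    by (auto simp: K_def)
  also have "closed \<dots>"
    by (intro closed_Int closed_INT ballI closed_Collect_all closed_Collect_eq closed_Collect_le
        continuous_intros c)
  finally have "closed K" .
  then have "compact K'" unfolding K'_def by (intro compact_Int_closed compact_Pi_UNIV) auto
  moreover have ip_T0: "ip W (act k d (mat_id k) T) (act k d (mat_id k) T) = ip W T T"
    by (rule ip_act) (rule orth_id)
  have T0': "act k d (mat_id k) T \<in> K'"
    using T0 box[OF T0] ip_T0 by (auto simp: K'_def abs_le_iff minus_le_iff)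
  moreover have "continuous_on K' (\<lambda>S. ip W S S)"
    by (intro continuous_intros continuous_on_subset[OF c]) auto
  ultimately obtain q where q: "q \<in> K'" "\<And>S. S \<in> K' \<Longrightarrow> ip W q q \<le> ip W S S"
    using continuous_attains_inf[of K' "\<lambda>S. ip W S S"] by blast
  have qK: "q \<in> K" using q by (simp add: K'_def)
  have min: "ip W q q \<le> ip W S S" if "S \<in> K" for S
  proof (cases "ip W S S \<le> ip W T T")
    case True
    then show ?thesis using q(2)[of S] box[OF that] that by (auto simp: K'_def abs_le_iff minus_le_iff)
  next
    case False
    then show ?thesis using q(2)[OF T0'] ip_T0 by linarith
  qed
  have uniq: "S = q" if S: "S \<in> K" "ip W S S = ip W q q" for S
  proof -
    have "(\<lambda>l. (1/2) * q l + (1/2) * S l) \<in> K"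
    proof -
      have "c \<le> ip W p (\<lambda>l. (1/2) * q l + (1/2) * S l)"
        if "\<forall>R\<in>orth k. c \<le> ip W p (act k d R T)" for p c
      proof -
        have "c \<le> ip W p q" "c \<le> ip W p S" using that S(1) qK unfolding K_def by blast+
        then show ?thesis by (simp add: ip_add_right ip_scale_right del: times_divide_eq_left)
      qed
      then show ?thesis using S(1) qK by (simp add: K_def)
    qed
    then have "ip W q q \<le> ip W (\<lambda>l. (1/2) * q l + (1/2) * S l) (\<lambda>l. (1/2) * q l + (1/2) * S l)"
      by (rule min)
    \<comment> \<open>The parallelogram identity; minimality at the midpoint makes its right side at
      most 0.\<close>
    moreover have "ip W (\<lambda>l. q l - S l) (\<lambda>l. q l - S l) = 2 * ip W q q + 2 * ip W S S
        - 4 * ip W (\<lambda>l. (1/2) * q l + (1/2) * S l) (\<lambda>l. (1/2) * q l + (1/2) * S l)"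
      unfolding ip_def sum_distrib_left sum.distrib[symmetric] sum_subtractf[symmetric]
      by (rule sum.cong) (auto simp: algebra_simps)
    ultimately have "ip W (\<lambda>l. q l - S l) (\<lambda>l. q l - S l) = 0"
      using S ip_self_nonneg[of W "\<lambda>l. q l - S l"] by linarith
    then have "\<forall>l\<in>W. S l = q l" using W by (simp add: ip_self_eq_0)
    then show ?thesis using S qK by (auto simp: K_def fun_eq_iff)
  qed
  have inv: "act k d R q = q" if "R \<in> orth k" for R
    using uniq[OF act_K[OF qK that]] ip_act[OF that] by simp
  have "\<exists>R\<in>orth k. ip W p (act k d R (\<lambda>l. T l - q l)) < ip W p p" if p: "ip W p p > 0" for p
  proof (rule ccontr)
    assume "\<not> ?thesis"
    then have *: "\<And>R. R \<in> orth k \<Longrightarrow> ip W p p \<le> ip W p (act k d R (\<lambda>l. T l - q l))"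
      by (auto simp: not_less)
    \<comment> \<open>The orbit would lie in a half-space that excludes \<open>q\<close>, although
      \<open>q\<close> lies in the hull.\<close>
    have "ip W p p + ip W p q \<le> ip W p (act k d R T)" if "R \<in> orth k" for R
      using *[OF that] inv[OF that] by (simp add: act_diff[abs_def] ip_diff_right)
    then have "ip W p p + ip W p q \<le> ip W p q" using qK unfolding K_def by blast
    then show False using p by simp
  qed
  then show ?thesis using inv by blast
qed

text \<open>After subtraction of the centres \<open>q j\<close>, every orbit has 0 in its closed
  convex hull, and the colourful theorem gives a vanishing combination. Thus the combination of the
  rotated \<open>T j\<close> is that of the centres, an invariant tensor, whose form is constant on
  spheres by transitivity.\<close>

lemma radial_combination:
  fixes k d :: nat and T :: "nat \<Rightarrow> nat list \<Rightarrow> real"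
  defines "m \<equiv> card (words k d)"
  shows "\<exists>R l. (\<forall>j. R j \<in> orth k) \<and> (\<forall>j\<le>m. 0 \<le> l j) \<and> (\<Sum>j\<le>m. l j) = (1::real) \<and>
    (\<forall>x y. std_quad k x = std_quad k y \<longrightarrow>
      (\<Sum>j\<le>m. l j * form k d (T j) (mat_vec k (R j) x)) = (\<Sum>j\<le>m. l j * form k d (T j) (mat_vec k (R j) y)))"
proof -
  let ?W = "words k d"
  have "\<forall>j. \<exists>q. (\<forall>R\<in>orth k. act k d R q = q) \<and>
     (\<forall>p. ip ?W p p > 0 \<longrightarrow> (\<exists>R\<in>orth k. ip ?W p (act k d R (\<lambda>l. T j l - q l)) < ip ?W p p))"
    using orbit_centre by blast
  then obtain q where q: "\<And>j R. R \<in> orth k \<Longrightarrow> act k d R (q j) = q j"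
    "\<And>j p. ip ?W p p > 0 \<Longrightarrow> \<exists>R\<in>orth k. ip ?W p (act k d R (\<lambda>l. T j l - q j l)) < ip ?W p p"
    by metis
  define C where "C j = (\<lambda>R. act k d R (\<lambda>l. T j l - q j l)) ` orth k" for j
  have 1: "compact (C j)" for j
    unfolding C_def by (intro compact_continuous_image continuous_on_act compact_orth)
  have 2: "C j \<noteq> {}" for j using orth_id by (auto simp: C_def)
  have 3: "\<exists>c\<in>C j. ip ?W p c < ip ?W p p" if "ip ?W p p > 0" for j p
    using q(2)[OF that, of j] by (auto simp: C_def)
  obtain c l where c: "\<And>j. c j \<in> C j" and l: "\<forall>j\<le>m. 0 \<le> l j" "(\<Sum>j\<le>m. l j) = (1::real)"
     "\<forall>i\<in>?W. (\<Sum>j\<le>m. l j * c j i) = 0"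
    using colourful_Caratheodory[of ?W C] 1 2 3 unfolding m_def by auto
  have "\<forall>j. \<exists>R. R \<in> orth k \<and> c j = act k d R (\<lambda>l. T j l - q j l)" using c by (auto simp: C_def)
  then obtain R where R: "\<And>j. R j \<in> orth k" "\<And>j. c j = act k d (R j) (\<lambda>l. T j l - q j l)" by metis
  define Q where "Q w = (\<Sum>j\<le>m. l j * q j w)" for w
  have "(\<Sum>j\<le>m. l j * act k d (R j) (T j) w) = Q w" if "w \<in> ?W" for w
  proof -
    have "0 = (\<Sum>j\<le>m. l j * (act k d (R j) (T j) w - q j w))"
      using l(3) that R q(1)[OF R(1)] by (simp add: act_diff)
    then show ?thesis by (simp add: Q_def right_diff_distrib sum_subtractf)
  qed
  then have "form k d Q x = (\<Sum>w\<in>?W. (\<Sum>j\<le>m. l j * act k d (R j) (T j) w) * word_prod w x)" for x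
    by (simp add: form_def)
  also have "\<dots> x = (\<Sum>j\<le>m. l j * form k d (act k d (R j) (T j)) x)" for x
    unfolding form_def sum_distrib_left sum_distrib_right by (subst sum.swap) (simp add: mult.assoc)
  finally have Q: "form k d Q x = (\<Sum>j\<le>m. l j * form k d (T j) (mat_vec k (mat_transpose (R j)) x))" for x
    by (simp add: form_act)
  have actQ: "act k d S Q w = Q w" if "S \<in> orth k" "w \<in> ?W" for S w
  proof -
    have "act k d S Q w = (\<Sum>j\<le>m. l j * act k d S (q j) w)"
      using that(2) unfolding act_def Q_def
      by (simp add: sum_distrib_left) (subst sum.swap, simp add: mult_ac)
    then show ?thesis using q(1)[OF that(1)] by (simp add: Q_def)
  qed
  have "form k d Q x = form k d Q y" if xy: "std_quad k x = std_quad k y" for x y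
  proof -
    obtain S where S: "S \<in> orth k" "\<And>i. i < k \<Longrightarrow> mat_vec k S x i = y i"
      using orth_transitive[OF xy] by blast
    have "form k d Q x = form k d (act k d (mat_transpose S) Q) x"
      unfolding form_def using actQ[OF orth_transpose[OF S(1)]] by simp
    also have "\<dots> = form k d Q (mat_vec k S x)" by (simp add: form_act)
    also have "\<dots> = form k d Q y"
      unfolding form_def word_prod_def
      by (intro sum.cong refl arg_cong2[where f = "(*)"] arg_cong[where f = prod_list] map_cong)
         (auto simp: words_def S)
    finally show ?thesis .
  qed
  then have "\<forall>x y. std_quad k x = std_quad k y \<longrightarrow>
      (\<Sum>j\<le>m. l j * form k d (T j) (mat_vec k (mat_transpose (R j)) x)) =
      (\<Sum>j\<le>m. l j * form k d (T j) (mat_vec k (mat_transpose (R j)) y))"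
    unfolding Q[symmetric] by blast
  \<comment> \<open>By \<open>form_act\<close>, acting with \<open>R j\<close> substitutes its
    transpose, so the transposes are the witnesses.\<close>
  moreover have "\<forall>j. mat_transpose (R j) \<in> orth k" using R(1) orth_transpose by blast
  ultimately show ?thesis using l(1,2) by (intro exI conjI)
qed

subsection \<open>Splitting forms along orthogonal subspaces\<close>

definition is_form :: "nat \<Rightarrow> nat \<Rightarrow> ((nat \<Rightarrow> real) \<Rightarrow> real) \<Rightarrow> bool" where
  "is_form n d f \<longleftrightarrow> (\<exists>T. f = form n d T)"

lemma is_form_cong:
  assumes "is_form n d f" "\<And>i. i < n \<Longrightarrow> x i = y i"
  shows "f x = f y"
proof -
  have "word_prod l x = word_prod l y" if "l \<in> words n d" for l
    unfolding word_prod_def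
    by (intro arg_cong[where f = prod_list] map_cong) (use that assms(2) in \<open>auto simp: words_def\<close>)
  then show ?thesis using assms(1) by (auto simp: is_form_def form_def)
qed

lemma word_prod_scale: "word_prod l (\<lambda>i. t * x i) = t ^ length l * word_prod l x"
  by (induction l) auto

lemma is_form_scale_arg:
  assumes "is_form n d f"
  shows "f (\<lambda>i. t * x i) = t ^ d * f x"
  using assms by (auto simp: is_form_def form_def word_prod_scale sum_distrib_left words_def mult_ac intro!: sum.cong)

lemma is_form_sum:
  assumes "\<And>a. a \<in> A \<Longrightarrow> is_form n d (g a)"
  shows "is_form n d (\<lambda>x. \<Sum>a\<in>A. c a * g a x)"
proof -
  obtain T where T: "\<And>a. a \<in> A \<Longrightarrow> g a = form n d (T a)"
    using assms unfolding is_form_def by metis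
  have "(\<Sum>a\<in>A. c a * g a x) = form n d (\<lambda>l. \<Sum>a\<in>A. c a * T a l) x" for x
    unfolding form_def sum_distrib_right
    by (subst sum.swap) (simp add: T form_def sum_distrib_left mult.assoc)
  then show ?thesis unfolding is_form_def by blast
qed

lemma is_form_word_prod:
  assumes "l \<in> words n d"
  shows "is_form n d (word_prod l)"
proof -
  have "word_prod l x = form n d (\<lambda>l'. if l' = l then 1 else 0) x" for x
    using assms by (simp add: form_def if_distrib[of "\<lambda>c. c * _"] cong: if_cong)
  then show ?thesis unfolding is_form_def by blast
qed

lemma is_form_mat_vec:
  assumes "is_form n d f"
  shows "is_form k d (\<lambda>x. f (mat_vec k M x))"
proof -
  obtain T where T: "f = form n d T" using assms by (auto simp: is_form_def)
  have "f (mat_vec k M x) = (\<Sum>l\<in>words n d. T l * (\<Sum>l'\<in>words k d. kron M l l' * word_prod l' x))" for x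
    unfolding T form_def by (rule sum.cong) (auto simp: words_def word_prod_mat_vec)
  moreover have "is_form k d (\<lambda>x. \<Sum>l\<in>words n d. T l * (\<Sum>l'\<in>words k d. kron M l l' * word_prod l' x))"
    by (intro is_form_sum is_form_word_prod)
  ultimately show ?thesis by simp
qed

lemma std_quad_scale: "std_quad n (\<lambda>i. t * x i) = t\<^sup>2 * std_quad n x"
  by (simp add: std_quad_def power_mult_distrib sum_distrib_left)

lemma std_quad_nonneg: "0 \<le> std_quad n x"
  by (simp add: std_quad_def sum_nonneg)

lemma mat_vec_scale: "mat_vec k M (\<lambda>i. t * x i) = (\<lambda>i. t * mat_vec k M x i)"
  by (simp add: mat_vec_def sum_distrib_left mult_ac)

lemma mat_vec_sum: "mat_vec k M (\<lambda>i. \<Sum>a\<in>A. x a i) = (\<lambda>i. \<Sum>a\<in>A. mat_vec k M (x a) i)"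
  unfolding mat_vec_def sum_distrib_left by (subst sum.swap) simp

section \<open>Isometric embeddings and radial forms\<close>

definition isometric :: "nat \<Rightarrow> nat \<Rightarrow> (nat \<Rightarrow> nat \<Rightarrow> real) \<Rightarrow> bool" where
  "isometric k n M \<longleftrightarrow> (\<forall>x. std_quad n (mat_vec k M x) = std_quad k x)"

lemma isometric_mat_mul:
  "isometric m n A \<Longrightarrow> isometric k m B \<Longrightarrow> isometric k n (mat_mul m A B)"
  by (simp add: isometric_def mat_vec_mat_mul)

lemma isometric_id:
  assumes "k \<le> n"
  shows "isometric k n (mat_id k)"
proof -
  have "mat_vec k (mat_id k) x i = (if i < k then x i else 0)" for x i
    by (simp add: mat_vec_def mat_id_def if_distrib[of "\<lambda>c. c * _"] cong: if_cong)
  moreover have "{..<n} \<inter> {..<k} = {..<k}" using assms by auto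
  ultimately show ?thesis
    by (simp add: isometric_def std_quad_def if_distrib[of "\<lambda>c. c ^ 2"] sum.If_cases lessThan_def cong: if_cong)
qed

text \<open>The square root allows all parities of \<open>d\<close>: the mixed parts in the
  induction have odd degrees as well.\<close>

definition radial :: "nat \<Rightarrow> nat \<Rightarrow> ((nat \<Rightarrow> real) \<Rightarrow> real) \<Rightarrow> bool" where
  "radial k d g \<longleftrightarrow> (\<exists>c. \<forall>x. g x = c * sqrt (std_quad k x) ^ d)"

lemma radial_isometric:
  "radial n d g \<Longrightarrow> isometric k n M \<Longrightarrow> radial k d (\<lambda>x. g (mat_vec k M x))"
  by (auto simp: radial_def isometric_def)

text \<open>By homogeneity the value at one unit vector determines a form that is constant on
  spheres. For \<open>k = 0\<close> there is no unit vector, but then a form of positive degree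
  vanishes.\<close>

lemma radialI:
  assumes f: "is_form k d f" and d: "d > 0"
    and inv: "\<And>x y. std_quad k x = std_quad k y \<Longrightarrow> f x = f y"
  shows "radial k d f"
proof (cases "k = 0")
  case True
  have "f x = 0" for x
  proof -
    have "f x = f (\<lambda>i. 0 * x i)" by (rule is_form_cong[OF f]) (simp add: True)
    then show ?thesis using is_form_scale_arg[OF f, of 0 x] d by (simp add: zero_power)
  qed
  then show ?thesis by (auto simp: radial_def)
next
  case False
  define e where "e i = (if i = 0 then 1 else 0 :: real)" for i :: nat
  have e: "std_quad k e = 1" using False
    by (simp add: std_quad_def e_def if_distrib[of "\<lambda>c. c ^ 2"] cong: if_cong)
  have "f x = f e * sqrt (std_quad k x) ^ d" for x
  proof -
    have "f x = f (\<lambda>i. sqrt (std_quad k x) * e i)"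
      by (rule inv) (simp add: std_quad_scale e std_quad_nonneg)
    then show ?thesis using is_form_scale_arg[OF f] by simp
  qed
  then show ?thesis unfolding radial_def by blast
qed

text \<open>Embeddings stand in for subspaces because they compose and preserve radial forms under
  restriction.\<close>

definition dvoretzky :: "nat \<Rightarrow> bool" where
  "dvoretzky d \<longleftrightarrow> (\<forall>k. \<exists>N. \<forall>n\<ge>N. \<forall>f. is_form n d f \<longrightarrow>
     (\<exists>M. isometric k n M \<and> radial k d (\<lambda>x. f (mat_vec k M x))))"

text \<open>The forms are treated one after another: first \<open>f a\<close> is made radial on a
  space of dimension \<open>N1\<close>, large enough for the others, and it stays radial on every
  subspace chosen later.\<close>

lemma dvoretzky_family:
  assumes "finite J" "\<And>j. j \<in> J \<Longrightarrow> dvoretzky (e j)"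
  shows "\<exists>N. \<forall>n\<ge>N. \<forall>f. (\<forall>j\<in>J. is_form n (e j) (f j)) \<longrightarrow>
     (\<exists>M. isometric k n M \<and> (\<forall>j\<in>J. radial k (e j) (\<lambda>x. f j (mat_vec k M x))))"
  using assms
proof (induction J rule: finite_induct)
  case empty
  then show ?case using isometric_id by (intro exI[of _ k]) auto
next
  case (insert a J)
  obtain N1 where N1: "\<And>n f. n \<ge> N1 \<Longrightarrow> (\<forall>j\<in>J. is_form n (e j) (f j)) \<Longrightarrow>
     (\<exists>M. isometric k n M \<and> (\<forall>j\<in>J. radial k (e j) (\<lambda>x. f j (mat_vec k M x))))"
    using insert.IH[OF insert.prems[OF insertI2]] by blast
  have "dvoretzky (e a)" using insert.prems by simp
  then obtain N where N: "\<And>n f. n \<ge> N \<Longrightarrow> is_form n (e a) f \<Longrightarrow>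
     \<exists>M. isometric N1 n M \<and> radial N1 (e a) (\<lambda>x. f (mat_vec N1 M x))"
    unfolding dvoretzky_def by metis
  show ?case
  proof (intro exI[of _ N] allI impI)
    fix n f assume n: "n \<ge> N" and f: "\<forall>j\<in>insert a J. is_form n (e j) (f j)"
    obtain A where A: "isometric N1 n A" "radial N1 (e a) (\<lambda>x. f a (mat_vec N1 A x))"
      using N[OF n, of "f a"] f by auto
    have "\<forall>j\<in>J. is_form N1 (e j) (\<lambda>x. f j (mat_vec N1 A x))"
      using f by (auto intro: is_form_mat_vec)
    from N1[OF le_refl this] obtain B where B: "isometric k N1 B"
      "\<forall>j\<in>J. radial k (e j) (\<lambda>x. f j (mat_vec N1 A (mat_vec k B x)))" by blast
    show "\<exists>M. isometric k n M \<and> (\<forall>j\<in>insert a J. radial k (e j) (\<lambda>x. f j (mat_vec k M x)))"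
      using isometric_mat_mul[OF A(1) B(1)] B(2) radial_isometric[OF A(2) B(1)]
      by (intro exI[of _ "mat_mul N1 A B"]) (auto simp: mat_vec_mat_mul)
  qed
qed

section \<open>Forms on an orthogonal sum\<close>

definition join :: "nat \<Rightarrow> (nat \<Rightarrow> real) \<Rightarrow> (nat \<Rightarrow> real) \<Rightarrow> nat \<Rightarrow> real" where
  "join m x y = (\<lambda>i. if i < m then x i else y (i - m))"

lemma std_quad_join: "std_quad (m + n) (join m x y) = std_quad m x + std_quad n y"
proof -
  have "std_quad (m + n) z = (\<Sum>i<m. (z i)\<^sup>2) + (\<Sum>i<n. (z (m + i))\<^sup>2)" for z
    by (induction n) (auto simp: std_quad_def)
  then show ?thesis by (simp add: std_quad_def join_def)
qed

definition short_words :: "nat \<Rightarrow> nat \<Rightarrow> nat list set" where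
  "short_words m d = {l. set l \<subseteq> {..<m} \<and> length l \<le> d}"

lemma finite_short_words: "finite (short_words m d)"
  unfolding short_words_def by (rule finite_lists_length_le) simp

lemma word_prod_join:
  "word_prod l (join m x y) =
    word_prod (filter (\<lambda>i. i < m) l) x * word_prod (map (\<lambda>i. i - m) (filter (\<lambda>i. \<not> i < m) l)) y"
  by (induction l) (auto simp: join_def)

text \<open>Words are grouped by their subword of letters below \<open>m\<close>; the remaining
  letters, shifted by \<open>m\<close>, yield the coefficient \<open>h\<close>, a form in
  \<open>y\<close> of complementary degree.\<close>

lemma form_join:
  assumes "is_form (m + n) d f"
  obtains h where "\<And>l. l \<in> short_words m d \<Longrightarrow> is_form n (d - length l) (h l)"
    "\<And>x y. f (join m x y) = (\<Sum>l\<in>short_words m d. word_prod l x * h l y)"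
proof -
  obtain T where T: "f = form (m + n) d T" using assms by (auto simp: is_form_def)
  define S where "S l' = {l \<in> words (m + n) d. filter (\<lambda>i. i < m) l = l'}" for l'
  define r where "r l = map (\<lambda>i. i - m) (filter (\<lambda>i. \<not> i < m) l)" for l
  define h where "h l' y = (\<Sum>l\<in>S l'. T l * word_prod (r l) y)" for l' y
  show ?thesis
  proof (rule that[of h])
    fix l' assume "l' \<in> short_words m d"
    show "is_form n (d - length l') (h l')" unfolding h_def
    proof (rule is_form_sum, rule is_form_word_prod)
      fix l assume l: "l \<in> S l'"
      have "length l = length (filter (\<lambda>i. i < m) l) + length (filter (\<lambda>i. \<not> i < m) l)"
        by (rule sum_length_filter_compl[symmetric])
      then show "r l \<in> words n (d - length l')"
        using l by (auto simp: S_def r_def words_def)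
    qed
  next
    fix x y
    have "f (join m x y) = (\<Sum>l\<in>words (m + n) d. T l * (word_prod (filter (\<lambda>i. i < m) l) x * word_prod (r l) y))"
      by (simp add: T form_def word_prod_join r_def)
    also have "\<dots> = (\<Sum>l'\<in>short_words m d. \<Sum>l\<in>S l'. T l * (word_prod (filter (\<lambda>i. i < m) l) x * word_prod (r l) y))"
      unfolding S_def
      by (rule sum.group[symmetric])
         (auto simp: finite_short_words, auto simp: short_words_def words_def)
    also have "\<dots> = (\<Sum>l\<in>short_words m d. word_prod l x * h l y)"
      by (rule sum.cong) (auto simp: h_def S_def sum_distrib_left mult_ac intro!: sum.cong)
    finally show "f (join m x y) = (\<Sum>l\<in>short_words m d. word_prod l x * h l y)" .
  qed
qed

lemma is_form_zero_arg: "is_form n d f \<Longrightarrow> d > 0 \<Longrightarrow> f (\<lambda>_. 0) = 0"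
  using is_form_scale_arg[of n d f 0] by (simp add: zero_power)

lemma is_form_0_const: "is_form n 0 f \<Longrightarrow> f x = f y"
  using is_form_scale_arg[of n 0 f 0 x] is_form_scale_arg[of n 0 f 0 y] by simp

text \<open>The order of choices matters. First \<open>m\<close> is fixed, for simultaneous
  restriction to dimension \<open>k\<close> of one form of each degree from 1 to
  \<open>d - 1\<close>. This leaves finitely many mixed coefficients \<open>h w\<close>, in number
  independent of \<open>n\<close>, and \<open>N\<close> is chosen to make them all radial in
  \<open>y\<close>. Only then are the forms in \<open>x\<close> known to which the choice of
  \<open>m\<close> applies.\<close>

lemma two_blocks:
  assumes d: "d > 0" and IH: "\<And>e. e < d \<Longrightarrow> dvoretzky e"
  shows "\<exists>N. \<forall>n\<ge>N. \<forall>f. is_form n d f \<longrightarrow> (\<exists>A B C.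
     (\<forall>x y. std_quad n (\<lambda>i. mat_vec k A x i + mat_vec l B y i) = std_quad k x + std_quad l y) \<and>
     (\<forall>x y. f (\<lambda>i. mat_vec k A x i + mat_vec l B y i) =
        f (mat_vec k A x) + f (mat_vec l B y) + C (std_quad k x) (std_quad l y)))"
proof -
  have "\<exists>N. \<forall>n\<ge>N. \<forall>f. (\<forall>j\<in>{1..<d}. is_form n j (f j)) \<longrightarrow>
     (\<exists>M. isometric k n M \<and> (\<forall>j\<in>{1..<d}. radial k j (\<lambda>x. f j (mat_vec k M x))))"
    using dvoretzky_family[of "{1..<d}" "\<lambda>j. j" k] IH by simp
  then obtain m where m: "\<And>f. (\<forall>j\<in>{1..<d}. is_form m j (f j)) \<Longrightarrow>
     (\<exists>M. isometric k m M \<and> (\<forall>j\<in>{1..<d}. radial k j (\<lambda>x. f j (mat_vec k M x))))" by blast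
  define J where "J = {w \<in> short_words m d. 0 < length w \<and> length w < d}"
  have J: "finite J" by (simp add: J_def finite_short_words)
  obtain N where N: "\<And>n h. n \<ge> N \<Longrightarrow> (\<forall>w\<in>J. is_form n (d - length w) (h w)) \<Longrightarrow>
     (\<exists>M. isometric l n M \<and> (\<forall>w\<in>J. radial l (d - length w) (\<lambda>x. h w (mat_vec l M x))))"
  proof -
    have "dvoretzky (d - length w)" if "w \<in> J" for w using that IH by (simp add: J_def)
    then have "\<exists>N. \<forall>n\<ge>N. \<forall>h. (\<forall>w\<in>J. is_form n (d - length w) (h w)) \<longrightarrow>
       (\<exists>M. isometric l n M \<and> (\<forall>w\<in>J. radial l (d - length w) (\<lambda>x. h w (mat_vec l M x))))"
      using J by (rule dvoretzky_family[rotated])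
    then show ?thesis using that by blast
  qed
  show ?thesis
  proof (intro exI[of _ "m + N"] allI impI)
    fix n f assume n: "n \<ge> m + N" and f: "is_form n d f"
    define n' where "n' = n - m"
    have n': "n = m + n'" "n' \<ge> N" using n by (auto simp: n'_def)
    obtain h where h: "\<And>w. w \<in> short_words m d \<Longrightarrow> is_form n' (d - length w) (h w)"
      "\<And>x y. f (join m x y) = (\<Sum>w\<in>short_words m d. word_prod w x * h w y)"
      using form_join[of m n' d f] f n' by metis
    (* Only the words of intermediate length survive: the others depend on x or y alone. *)
    have cross: "f (join m x y) - f (join m x (\<lambda>_. 0)) - f (join m (\<lambda>_. 0) y)
        = (\<Sum>w\<in>J. word_prod w x * h w y)" for x y
    proof -
      have "word_prod w x * h w y - word_prod w x * h w (\<lambda>_. 0) - word_prod w (\<lambda>_. 0) * h w y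
         = (if w \<in> J then word_prod w x * h w y else 0)" if w: "w \<in> short_words m d" for w
      proof -
        consider "w = []" | "length w = d" | "w \<in> J"
          using w by (auto simp: J_def short_words_def le_less)
        then show ?thesis
        proof cases
          case 1
          then show ?thesis using is_form_zero_arg[OF h(1)[OF w]] d by (simp add: J_def)
        next
          case 2
          have "word_prod w (\<lambda>_. 0) = 0" using 2 d by (cases w) auto
          moreover have "h w y = h w (\<lambda>_. 0)"
            using is_form_0_const[of n' "h w"] h(1)[OF w] 2 by simp
          ultimately show ?thesis using 2 by (simp add: J_def)
        next
          case 3
          then have "word_prod w (\<lambda>_. 0) = 0" by (cases w) (auto simp: J_def)
          moreover have "h w (\<lambda>_. 0) = 0"
            using is_form_zero_arg[OF h(1)[OF w]] 3 by (simp add: J_def)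
          ultimately show ?thesis using 3 by simp
        qed
      qed
      then show ?thesis
        unfolding h(2) sum_subtractf[symmetric]
        by (simp add: J_def sum.If_cases finite_short_words Int_def cong: sum.cong)
    qed
    obtain B0 where B0: "isometric l n' B0"
      "\<And>w. w \<in> J \<Longrightarrow> radial l (d - length w) (\<lambda>x. h w (mat_vec l B0 x))"
      using N[OF n'(2), of h] h(1) by (auto simp: J_def)
    then obtain c where c: "\<And>w y. w \<in> J \<Longrightarrow> h w (mat_vec l B0 y) = c w * sqrt (std_quad l y) ^ (d - length w)"
      unfolding radial_def by metis
    \<comment> \<open>With the \<open>h w\<close> radial, \<open>p j\<close> is the coefficient of
      the power \<open>d - j\<close> of the norm of \<open>y\<close> in the mixed part.\<close>
    define p where "p j x = (\<Sum>w\<in>words m j. c w * word_prod w x)" for j x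
    have "is_form m j (p j)" for j
      unfolding p_def by (intro is_form_sum is_form_word_prod)
    then obtain A0 where A0: "isometric k m A0"
      "\<And>j. j \<in> {1..<d} \<Longrightarrow> radial k j (\<lambda>x. p j (mat_vec k A0 x))"
      using m[of p] by auto
    then obtain b where b: "\<And>j x. j \<in> {1..<d} \<Longrightarrow> p j (mat_vec k A0 x) = b j * sqrt (std_quad k x) ^ j"
      unfolding radial_def by metis
    define A B where "A i j = (if i < m then A0 i j else 0)"
      and "B i j = (if i < m then 0 else B0 (i - m) j)" for i j
    define C where "C s t = (\<Sum>j\<in>{1..<d}. b j * sqrt s ^ j * sqrt t ^ (d - j))" for s t
    have AB: "(\<lambda>i. mat_vec k A x i + mat_vec l B y i) = join m (mat_vec k A0 x) (mat_vec l B0 y)" for x y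
      by (auto simp: A_def B_def join_def mat_vec_def)
    have A: "mat_vec k A x = join m (mat_vec k A0 x) (\<lambda>_. 0)" for x
      by (auto simp: A_def join_def mat_vec_def)
    have B: "mat_vec l B y = join m (\<lambda>_. 0) (mat_vec l B0 y)" for y
      by (auto simp: B_def join_def mat_vec_def)
    have "f (\<lambda>i. mat_vec k A x i + mat_vec l B y i) =
        f (mat_vec k A x) + f (mat_vec l B y) + C (std_quad k x) (std_quad l y)" for x y
    proof -
      have "f (\<lambda>i. mat_vec k A x i + mat_vec l B y i) - f (mat_vec k A x) - f (mat_vec l B y)
         = (\<Sum>w\<in>J. word_prod w (mat_vec k A0 x) * (c w * sqrt (std_quad l y) ^ (d - length w)))"
        unfolding AB unfolding A B cross by (simp add: c)
      also have "\<dots> = (\<Sum>j\<in>{1..<d}. \<Sum>w\<in>{w\<in>J. length w = j}. word_prod w (mat_vec k A0 x) * (c w * sqrt (std_quad l y) ^ (d - length w)))"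
        by (rule sum.group[symmetric]) (auto simp: J, auto simp: J_def Suc_le_eq)
      also have "\<dots> = (\<Sum>j\<in>{1..<d}. p j (mat_vec k A0 x) * sqrt (std_quad l y) ^ (d - j))"
      proof (rule sum.cong[OF refl])
        fix j assume "j \<in> {1..<d}"
        then have "{w\<in>J. length w = j} = words m j" by (auto simp: J_def short_words_def words_def)
        then show "(\<Sum>w\<in>{w\<in>J. length w = j}. word_prod w (mat_vec k A0 x) * (c w * sqrt (std_quad l y) ^ (d - length w)))
           = p j (mat_vec k A0 x) * sqrt (std_quad l y) ^ (d - j)"
          unfolding p_def sum_distrib_right
          by (intro sum.cong) (auto simp: words_def)
      qed
      also have "\<dots> = C (std_quad k x) (std_quad l y)" by (simp add: C_def b)
      finally show ?thesis by simp
    qed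
    moreover have "std_quad n (\<lambda>i. mat_vec k A x i + mat_vec l B y i) = std_quad k x + std_quad l y" for x y
      using A0(1) B0(1) by (simp add: AB n'(1) std_quad_join isometric_def)
    ultimately show "\<exists>A B C.
     (\<forall>x y. std_quad n (\<lambda>i. mat_vec k A x i + mat_vec l B y i) = std_quad k x + std_quad l y) \<and>
     (\<forall>x y. f (\<lambda>i. mat_vec k A x i + mat_vec l B y i) =
        f (mat_vec k A x) + f (mat_vec l B y) + C (std_quad k x) (std_quad l y))" by blast
  qed
qed

text \<open>One block is split off from a complement of dimension \<open>L\<close>, large enough for
  the other \<open>m\<close>; the restriction of \<open>f\<close> to that complement is again a form
  of degree \<open>d\<close>.\<close>

lemma many_blocks:
  fixes m :: nat
  assumes d: "d > 0" and IH: "\<And>e. e < d \<Longrightarrow> dvoretzky e"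
  shows "\<exists>N. \<forall>n\<ge>N. \<forall>f. is_form n d f \<longrightarrow> (\<exists>A C.
     (\<forall>X. std_quad n (\<lambda>i. \<Sum>j<m. mat_vec k (A j) (X j) i) = (\<Sum>j<m. std_quad k (X j))) \<and>
     (\<forall>X. f (\<lambda>i. \<Sum>j<m. mat_vec k (A j) (X j) i) =
        (\<Sum>j<m. f (mat_vec k (A j) (X j))) + C (\<lambda>j. std_quad k (X j))))"
proof (induction m)
  case 0
  show ?case
  proof (intro exI[of _ "0::nat"] allI impI)
    fix n and f :: "(nat \<Rightarrow> real) \<Rightarrow> real"
    show "\<exists>(A :: nat \<Rightarrow> nat \<Rightarrow> nat \<Rightarrow> real) C.
     (\<forall>X. std_quad n (\<lambda>i. \<Sum>j<0. mat_vec k (A j) (X j) i) = (\<Sum>j<0. std_quad k (X j))) \<and>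
     (\<forall>X. f (\<lambda>i. \<Sum>j<0. mat_vec k (A j) (X j) i) =
        (\<Sum>j<0. f (mat_vec k (A j) (X j))) + C (\<lambda>j. std_quad k (X j)))"
      by (intro exI[of _ "\<lambda>_. f (\<lambda>_. 0)"] exI[of _ "\<lambda>_ _ _. 0"]) (auto simp: std_quad_def)
  qed
next
  case (Suc m)
  then obtain L where L: "\<And>f. is_form L d f \<Longrightarrow> \<exists>A C.
     (\<forall>X. std_quad L (\<lambda>i. \<Sum>j<m. mat_vec k (A j) (X j) i) = (\<Sum>j<m. std_quad k (X j))) \<and>
     (\<forall>X. f (\<lambda>i. \<Sum>j<m. mat_vec k (A j) (X j) i) =
        (\<Sum>j<m. f (mat_vec k (A j) (X j))) + C (\<lambda>j. std_quad k (X j)))" by blast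
  obtain N where N: "\<And>n f. n \<ge> N \<Longrightarrow> is_form n d f \<Longrightarrow> \<exists>A B C.
     (\<forall>x y. std_quad n (\<lambda>i. mat_vec k A x i + mat_vec L B y i) = std_quad k x + std_quad L y) \<and>
     (\<forall>x y. f (\<lambda>i. mat_vec k A x i + mat_vec L B y i) =
        f (mat_vec k A x) + f (mat_vec L B y) + C (std_quad k x) (std_quad L y))"
    using two_blocks[OF d IH, of k L] by blast
  show ?case
  proof (intro exI[of _ N] allI impI)
    fix n f assume n: "n \<ge> N" and f: "is_form n d f"
    obtain A0 B C0 where A0: "\<And>x y. std_quad n (\<lambda>i. mat_vec k A0 x i + mat_vec L B y i) = std_quad k x + std_quad L y"
      "\<And>x y. f (\<lambda>i. mat_vec k A0 x i + mat_vec L B y i) =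
        f (mat_vec k A0 x) + f (mat_vec L B y) + C0 (std_quad k x) (std_quad L y)"
      using N[OF n f] by blast
    obtain A1 C1 where A1: "\<And>X. std_quad L (\<lambda>i. \<Sum>j<m. mat_vec k (A1 j) (X j) i) = (\<Sum>j<m. std_quad k (X j))"
      "\<And>X. f (mat_vec L B (\<lambda>i. \<Sum>j<m. mat_vec k (A1 j) (X j) i)) =
        (\<Sum>j<m. f (mat_vec L B (mat_vec k (A1 j) (X j)))) + C1 (\<lambda>j. std_quad k (X j))"
      using L[OF is_form_mat_vec[OF f, of L B]] by blast
    define A where "A j = (if j < m then mat_mul L B (A1 j) else A0)" for j
    \<comment> \<open>The inner embedding is isometric, so the squared norm of the complement's
      vector is the sum of those of its blocks.\<close>
    define C where "C q = C1 q + C0 (q m) (\<Sum>j<m. q j)" for q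
    have split: "(\<lambda>i. \<Sum>j<Suc m. mat_vec k (A j) (X j) i) =
       (\<lambda>i. mat_vec k A0 (X m) i + mat_vec L B (\<lambda>i. \<Sum>j<m. mat_vec k (A1 j) (X j) i) i)" for X
      by (simp add: A_def mat_vec_mat_mul mat_vec_sum add.commute)
    have "std_quad n (\<lambda>i. \<Sum>j<Suc m. mat_vec k (A j) (X j) i) = (\<Sum>j<Suc m. std_quad k (X j))" for X
      unfolding split A0 A1 by simp
    moreover have "f (\<lambda>i. \<Sum>j<Suc m. mat_vec k (A j) (X j) i) =
        (\<Sum>j<Suc m. f (mat_vec k (A j) (X j))) + C (\<lambda>j. std_quad k (X j))" for X
      unfolding split A0 A1 by (simp add: A_def C_def mat_vec_mat_mul)
    ultimately show "\<exists>A C.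
     (\<forall>X. std_quad n (\<lambda>i. \<Sum>j<Suc m. mat_vec k (A j) (X j) i) = (\<Sum>j<Suc m. std_quad k (X j))) \<and>
     (\<forall>X. f (\<lambda>i. \<Sum>j<Suc m. mat_vec k (A j) (X j) i) =
        (\<Sum>j<Suc m. f (mat_vec k (A j) (X j))) + C (\<lambda>j. std_quad k (X j)))" by blast
  qed
qed

section \<open>The induction on the degree\<close>

lemma orth_isometric:
  assumes "R \<in> orth k"
  shows "std_quad k (mat_vec k R x) = std_quad k x"
proof -
  have "std_quad k (mat_vec k R x) = (\<Sum>i<k. \<Sum>s<k. \<Sum>t<k. R i s * x s * (R i t * x t))"
    by (simp add: std_quad_def mat_vec_def power2_eq_square sum_product)
  also have "\<dots> = (\<Sum>s<k. \<Sum>t<k. \<Sum>i<k. R i s * x s * (R i t * x t))"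
    by (subst sum.swap) (intro sum.cong refl sum.swap)
  also have "\<dots> = (\<Sum>s<k. \<Sum>t<k. mat_mul k (mat_transpose R) R s t * x s * x t)"
    by (simp add: mat_mul_def mat_transpose_def sum_distrib_right sum_distrib_left mult_ac)
  also have "\<dots> = (\<Sum>s<k. \<Sum>t<k. if t = s then x s * x s else 0)"
    using assms by (intro sum.cong refl) (auto simp: orth_def mat_id_def)
  finally show ?thesis by (simp add: std_quad_def power2_eq_square)
qed

lemma dvoretzky_step:
  assumes d: "d > 0" and IH: "\<And>e. e < d \<Longrightarrow> dvoretzky e"
  shows "dvoretzky d"
  unfolding dvoretzky_def
proof
  fix k
  define m where "m = card (words k d)"
  obtain N where N: "\<And>n f. n \<ge> N \<Longrightarrow> is_form n d f \<Longrightarrow> \<exists>A C.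
     (\<forall>X. std_quad n (\<lambda>i. \<Sum>j<Suc m. mat_vec k (A j) (X j) i) = (\<Sum>j<Suc m. std_quad k (X j))) \<and>
     (\<forall>X. f (\<lambda>i. \<Sum>j<Suc m. mat_vec k (A j) (X j) i) =
        (\<Sum>j<Suc m. f (mat_vec k (A j) (X j))) + C (\<lambda>j. std_quad k (X j)))"
    using many_blocks[OF d IH, where m = "Suc m" and k = k] by blast
  show "\<exists>N. \<forall>n\<ge>N. \<forall>f. is_form n d f \<longrightarrow>
     (\<exists>M. isometric k n M \<and> radial k d (\<lambda>x. f (mat_vec k M x)))"
  proof (intro exI[of _ N] allI impI)
    fix n f assume n: "n \<ge> N" and f: "is_form n d f"
    obtain A C where A: "\<And>X. std_quad n (\<lambda>i. \<Sum>j<Suc m. mat_vec k (A j) (X j) i) = (\<Sum>j<Suc m. std_quad k (X j))"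
      "\<And>X. f (\<lambda>i. \<Sum>j<Suc m. mat_vec k (A j) (X j) i) =
        (\<Sum>j<Suc m. f (mat_vec k (A j) (X j))) + C (\<lambda>j. std_quad k (X j))"
      using N[OF n f] by blast
    have "\<forall>j. \<exists>T. (\<lambda>x. f (mat_vec k (A j) x)) = form k d T"
      using is_form_mat_vec[OF f] unfolding is_form_def by blast
    then obtain T where T: "\<And>j x. f (mat_vec k (A j) x) = form k d (T j) x" by metis
    obtain R l where R: "\<And>j. R j \<in> orth k" and l: "\<And>j. j \<le> m \<Longrightarrow> 0 \<le> l j" "(\<Sum>j\<le>m. l j) = (1::real)"
      and rad: "\<And>x y. std_quad k x = std_quad k y \<Longrightarrow>
      (\<Sum>j\<le>m. l j * form k d (T j) (mat_vec k (R j) x)) = (\<Sum>j\<le>m. l j * form k d (T j) (mat_vec k (R j) y))"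
      using radial_combination[of k d T] unfolding m_def by blast
    \<comment> \<open>Scaling a block by \<open>t j\<close> multiplies its form by
      \<open>l j\<close>; the root is legitimate since \<open>l j\<close> is nonnegative.\<close>
    define t where "t j = root d (l j)" for j
    define s where "s = (\<Sum>j\<le>m. (t j)\<^sup>2)"
    have td: "t j ^ d = l j" if "j \<le> m" for j using l(1)[OF that] d by (simp add: t_def)
    have "s > 0"
    proof (rule ccontr)
      assume "\<not> s > 0"
      moreover have "s \<ge> 0" unfolding s_def by (simp add: sum_nonneg)
      ultimately have "s = 0" by simp
      then have "\<forall>j\<le>m. t j = 0" unfolding s_def by (subst (asm) sum_nonneg_eq_0_iff) auto
      then have "\<forall>j\<le>m. l j = 0" using td d by (metis zero_power)
      then show False using l(2) by simp
    qed
    \<comment> \<open>The squares of the \<open>t j\<close> need not sum to 1; \<open>a\<close>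
      normalises them so that \<open>M\<close> becomes isometric.\<close>
    define a where "a = 1 / sqrt s"
    define X where "X x j = (\<lambda>i. (a * t j) * mat_vec k (R j) x i)" for x j
    define M where "M = (\<lambda>i c. \<Sum>j<Suc m. a * t j * mat_mul k (A j) (R j) i c)"
    have M: "mat_vec k M x = (\<lambda>i. \<Sum>j<Suc m. mat_vec k (A j) (X x j) i)" for x
    proof -
      have "mat_vec k M x i = (\<Sum>j<Suc m. a * t j * mat_vec k (mat_mul k (A j) (R j)) x i)" for i
        unfolding M_def mat_vec_def sum_distrib_right sum_distrib_left
        by (subst sum.swap) (simp only: mult.assoc)
      then show ?thesis unfolding X_def mat_vec_scale mat_vec_mat_mul by (rule ext)
    qed
    have q: "std_quad k (X x j) = (a * t j)\<^sup>2 * std_quad k x" for x j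
      by (simp only: X_def std_quad_scale orth_isometric[OF R])
    have "isometric k n M"
    proof -
      have "(\<Sum>j\<le>m. (a * t j)\<^sup>2) = a\<^sup>2 * s"
        by (simp only: power_mult_distrib sum_distrib_left s_def)
      also have "\<dots> = 1" using \<open>s > 0\<close> by (simp add: a_def power_divide)
      finally have "(\<Sum>j\<le>m. (a * t j)\<^sup>2) = 1" .
      then show ?thesis
        unfolding isometric_def M A unfolding q sum_distrib_right[symmetric] lessThan_Suc_atMost by simp
    qed
    moreover have "radial k d (\<lambda>x. f (mat_vec k M x))"
    proof (rule radialI[OF is_form_mat_vec[OF f] d])
      \<comment> \<open>The first summand is radial by the choice of \<open>R\<close> and
        \<open>l\<close>, and the second sees only the norm of \<open>x\<close>.\<close>
      have fM: "f (mat_vec k M x) = a ^ d * (\<Sum>j\<le>m. l j * form k d (T j) (mat_vec k (R j) x))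
          + C (\<lambda>j. (a * t j)\<^sup>2 * std_quad k x)" for x
      proof -
        have "f (mat_vec k (A j) (X x j)) = a ^ d * (l j * form k d (T j) (mat_vec k (R j) x))" if "j \<le> m" for j
          unfolding X_def mat_vec_scale is_form_scale_arg[OF f] T
          using td[OF that] by (simp add: power_mult_distrib)
        then have "(\<Sum>j<Suc m. f (mat_vec k (A j) (X x j)))
            = a ^ d * (\<Sum>j\<le>m. l j * form k d (T j) (mat_vec k (R j) x))"
          unfolding sum_distrib_left lessThan_Suc_atMost by (intro sum.cong) auto
        then show ?thesis by (simp only: M A(2) q)
      qed
      show "f (mat_vec k M x) = f (mat_vec k M y)" if "std_quad k x = std_quad k y" for x y
        by (simp only: fM rad[OF that] that)
    qed
    ultimately show "\<exists>M. isometric k n M \<and> radial k d (\<lambda>x. f (mat_vec k M x))" by blast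
  qed
qed

lemma dvoretzky_all: "dvoretzky d"
proof (induction d rule: less_induct)
  case (less d)
  show ?case
  proof (cases "d = 0")
    case True
    have "radial k 0 (\<lambda>x. f (mat_vec k M x))" if "is_form n 0 f" for n k M f
      unfolding radial_def using is_form_0_const[OF that] by auto
    then show ?thesis using isometric_id unfolding True dvoretzky_def by blast
  next
    case False
    then show ?thesis using dvoretzky_step less by blast
  qed
qed

section \<open>From polynomials to forms, and from embeddings to subspaces\<close>

lemma is_form_poly_fun:
  assumes "homogeneous_poly n d p"
  shows "is_form n d (poly_fun p)"
proof -
  have "is_form n d (\<lambda>x. \<Prod>i\<in>Poly_Mapping.keys m. x i ^ Poly_Mapping.lookup m i)"
    if m: "m \<in> Poly_Mapping.keys p" for m
  proof -
    define g where "g = (\<lambda>i. replicate (Poly_Mapping.lookup m i) i)"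
    \<comment> \<open>The monomial becomes the word of its variables in increasing order, each
      repeated by its exponent.\<close>
    define l where "l = concat (map g (sorted_list_of_set (Poly_Mapping.keys m)))"
    have app: "word_prod (concat ls) x = prod_list (map (\<lambda>l. word_prod l x) ls)" for ls and x
      by (induction ls) (auto simp: word_prod_def)
    have rep: "word_prod (g i) x = x i ^ Poly_Mapping.lookup m i" for i x
      by (simp add: g_def word_prod_def)
    have wp: "word_prod l x = (\<Prod>i\<in>Poly_Mapping.keys m. x i ^ Poly_Mapping.lookup m i)" for x
      unfolding l_def app map_map o_def rep
      by (subst prod.distinct_set_conv_list[symmetric]) auto
    have "l \<in> words n d"
    proof -
      have "length l = (\<Sum>i\<in>Poly_Mapping.keys m. Poly_Mapping.lookup m i)"
        unfolding l_def length_concat map_map o_def g_def length_replicate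
        by (subst sum.distinct_set_conv_list[symmetric]) auto
      moreover have "set l \<subseteq> Poly_Mapping.keys m" by (auto simp: l_def g_def)
      ultimately show ?thesis using assms m by (auto simp: homogeneous_poly_def words_def)
    qed
    then have "is_form n d (word_prod l)" by (rule is_form_word_prod)
    then show ?thesis unfolding wp[abs_def] .
  qed
  then have "is_form n d (\<lambda>x. \<Sum>m\<in>Poly_Mapping.keys p. Poly_Mapping.lookup p m *
      (\<Prod>i\<in>Poly_Mapping.keys m. x i ^ Poly_Mapping.lookup m i))"
    by (rule is_form_sum)
  then show ?thesis by (simp add: poly_fun_def[abs_def])
qed

theorem theorem1:
  fixes d k :: nat
  assumes "even d" and "d > 0" and "k > 0"
  shows "\<exists>N>0. \<forall>n\<ge>N. \<forall>f. homogeneous_poly n d f \<longrightarrow>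
           (\<exists>V \<subseteq> Rn n. seq_space.subspace V \<and> seq_space.dim V = k \<and>
              proportional_on V (poly_fun f) (\<lambda>x. std_quad n x ^ (d div 2)))"
proof -
  obtain N where N: "\<And>n f. n \<ge> N \<Longrightarrow> is_form n d f \<Longrightarrow>
      \<exists>M. isometric k n M \<and> radial k d (\<lambda>x. f (mat_vec k M x))"
    using dvoretzky_all[of d] unfolding dvoretzky_def by blast
  show ?thesis
  \<comment> \<open>The successor guarantees a positive bound.\<close>
  proof (intro exI[of _ "Suc N"] conjI allI impI)
    fix n and f :: rpoly
    assume n: "Suc N \<le> n" and "homogeneous_poly n d f"
    then have f: "is_form n d (poly_fun f)" by (intro is_form_poly_fun)
    obtain M c where M: "isometric k n M"
      and c: "\<And>x. poly_fun f (mat_vec k M x) = c * sqrt (std_quad k x) ^ d"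
      using N[OF _ f] n unfolding radial_def by (metis Suc_leD)
    \<comment> \<open>The columns of \<open>M\<close>, cut off at \<open>n\<close> to lie in
      \<open>Rn n\<close>; neither \<open>poly_fun f\<close> nor \<open>std_quad n\<close> sees the
      entries removed.\<close>
    define v where "v j = (\<lambda>i. if i < n then M i j else 0)" for j
    have comb: "(\<Sum>j\<in>J. seq_scale (u j) (v j)) i = (\<Sum>j\<in>J. u j * v j i)" for J u i
      by (induction J rule: infinite_finite_induct) (auto simp: seq_scale_def)
    have comb_eq: "(\<Sum>j<k. seq_scale (u j) (v j)) i = mat_vec k M u i" if "i < n" for u i
      unfolding comb mat_vec_def using that by (simp add: v_def mult.commute)
    have quad: "std_quad n (\<Sum>j<k. seq_scale (u j) (v j)) = std_quad k u" for u
    proof -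
      have "std_quad n (\<Sum>j<k. seq_scale (u j) (v j)) = std_quad n (mat_vec k M u)"
        unfolding std_quad_def by (intro sum.cong refl) (simp add: comb_eq)
      then show ?thesis using M by (simp add: isometric_def)
    qed
    have inj0: "\<forall>j<k. u j = 0" if "(\<Sum>j<k. seq_scale (u j) (v j)) = 0" for u
    proof -
      have "std_quad k u = 0" unfolding quad[symmetric] that by (simp add: std_quad_def)
      then show ?thesis unfolding std_quad_def by (subst (asm) sum_nonneg_eq_0_iff) auto
    qed
    \<comment> \<open>Independence speaks of the set of columns, so the dimension is
      \<open>k\<close> only if they are distinct. Two equal ones would give a relation excluded by
      \<open>inj0\<close>.\<close>
    have inj: "inj_on v {..<k}"
    proof (rule inj_onI, rule ccontr)
      fix a b assume ab: "a \<in> {..<k}" "b \<in> {..<k}" "v a = v b" "a \<noteq> b"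
      define u where "u j = (if j = a then 1 else 0) - (if j = b then 1 else 0 :: real)" for j
      have "(\<Sum>j<k. seq_scale (u j) (v j)) i = (0 :: nat \<Rightarrow> real) i" for i
        using ab fun_cong[OF ab(3), of i]
        by (simp add: comb u_def left_diff_distrib sum_subtractf if_distrib[of "\<lambda>c. c * _"] cong: if_cong)
      then have "(\<Sum>j<k. seq_scale (u j) (v j)) = 0" by (rule ext)
      then have "u a = 0" using inj0[of u] ab by simp
      then show False using ab by (simp add: u_def)
    qed
    have ind: "seq_space.independent (v ` {..<k})"
    proof (rule seq_space.independent_if_scalars_zero)
      fix g x assume g: "(\<Sum>x\<in>v ` {..<k}. seq_scale (g x) x) = 0" and x: "x \<in> v ` {..<k}"
      have "(\<Sum>j<k. seq_scale (g (v j)) (v j)) = 0" using g by (simp add: sum.reindex[OF inj])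
      then show "g x = 0" using inj0[of "\<lambda>j. g (v j)"] x by auto
    qed simp
    define V where "V = seq_space.span (v ` {..<k})"
    have elem: "\<exists>u. x = (\<Sum>j<k. seq_scale (u j) (v j))" if "x \<in> V" for x
    proof -
      have "x \<in> range (\<lambda>u. \<Sum>v\<in>v ` {..<k}. seq_scale (u v) v)"
        using that unfolding V_def by (simp add: seq_space.span_finite)
      then obtain g where "x = (\<Sum>w\<in>v ` {..<k}. seq_scale (g w) w)" by blast
      then show ?thesis by (intro exI[of _ "\<lambda>j. g (v j)"]) (simp add: sum.reindex[OF inj])
    qed
    have "V \<subseteq> Rn n"
    proof
      fix x assume "x \<in> V"
      then obtain u where "x = (\<Sum>j<k. seq_scale (u j) (v j))" using elem by blast
      then show "x \<in> Rn n" by (simp only: Rn_def mem_Collect_eq comb) (simp add: v_def)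
    qed
    moreover have "seq_space.subspace V" by (simp add: V_def seq_space.subspace_span)
    moreover have "seq_space.dim V = k"
      using seq_space.dim_span_eq_card_independent[OF ind] card_image[OF inj] by (simp add: V_def)
    moreover have "proportional_on V (poly_fun f) (\<lambda>x. std_quad n x ^ (d div 2))"
      unfolding proportional_on_def
    proof (intro exI[of _ c] ballI)
      fix x assume "x \<in> V"
      then obtain u where u: "x = (\<Sum>j<k. seq_scale (u j) (v j))" using elem by blast
      have "poly_fun f x = poly_fun f (mat_vec k M u)"
        by (rule is_form_cong[OF f]) (simp add: u comb_eq)
      \<comment> \<open>Evenness of \<open>d\<close> turns the power of the norm into a power of the
        quadratic form.\<close>
      also have "\<dots> = c * sqrt (std_quad k u) ^ (2 * (d div 2))" using \<open>even d\<close> by (simp add: c)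
      also have "\<dots> = c * std_quad k u ^ (d div 2)"
        unfolding power_mult by (simp add: std_quad_nonneg)
      also have "\<dots> = c * std_quad n x ^ (d div 2)" unfolding u quad ..
      finally show "poly_fun f x = c * std_quad n x ^ (d div 2)" .
    qed
    ultimately show "\<exists>V \<subseteq> Rn n. seq_space.subspace V \<and> seq_space.dim V = k \<and>
        proportional_on V (poly_fun f) (\<lambda>x. std_quad n x ^ (d div 2))" by blast
  qed simp
qed

end
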